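(* There exist $\delta>0$ and $c>0$ such that for every even function $\epsilon\in H^1(\mathbb{R})$ with $(\epsilon,Q^3)_{L^2}=(\epsilon,iQ^3)_{L^2}=0$, $\|\epsilon\|_{L^2}\le\delta$ and $\|Q+\epsilon\|_{L^2}=\|Q\|_{L^2}$, one has $$E(Q+\epsilon)\ge c\,\|\epsilon\|_{H^1}^2 = c\Big(\int|\epsilon_x|^2\,dx + \int|\epsilon|^2\,dx\Big).$$
   Context: $Q(x)=(3/\cosh^2(2x))^{1/4}$; $(f,g)_{L^2}=\mathrm{Re}\int f\bar g$; $E(v)=\frac12\int|v_x|^2\,dx-\frac16\int|v|^6\,dx$. *)

theory Defs
  imports "HOL-Analysis.Analysis"
begin

definition Q :: "real \<Rightarrow> real" where
  "Q x = (3 / (cosh (2 * x))^2) powr (1/4)"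

definition Qc :: "real \<Rightarrow> complex" where
  "Qc x = complex_of_real (Q x)"

definition Qc' :: "real \<Rightarrow> complex" where
  "Qc' x = complex_of_real (deriv Q x)"

definition L2ip :: "(real \<Rightarrow> complex) \<Rightarrow> (real \<Rightarrow> complex) \<Rightarrow> real" where
  "L2ip f g = Re (LINT x|lborel. f x * cnj (g x))"

definition L2norm :: "(real \<Rightarrow> complex) \<Rightarrow> real" where
  "L2norm f = sqrt (LINT x|lborel. (cmod (f x))^2)"

text \<open>u \<in> H^1(\<real>) with weak derivative g: u and g are square integrable and u agrees
  almost everywhere with an absolutely continuous function v whose derivative is g
  (v b - v a = \<integral>_a^b g).\<close>
definition H1_with_deriv :: "(real \<Rightarrow> complex) \<Rightarrow> (real \<Rightarrow> complex) \<Rightarrow> bool" where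
  "H1_with_deriv u g \<longleftrightarrow>
     u \<in> borel_measurable lborel \<and> integrable lborel (\<lambda>x. (cmod (u x))^2) \<and>
     g \<in> borel_measurable lborel \<and> integrable lborel (\<lambda>x. (cmod (g x))^2) \<and>
     (\<exists>v. (AE x in lborel. u x = v x) \<and>
          (\<forall>a b. a \<le> b \<longrightarrow> v b - v a = (LBINT t=a..b. g t)))"

definition energy :: "(real \<Rightarrow> complex) \<Rightarrow> (real \<Rightarrow> complex) \<Rightarrow> real" where
  "energy v vx = (1/2) * (LINT x|lborel. (cmod (vx x))^2) - (1/6) * (LINT x|lborel. (cmod (v x))^6)"

end

theory Submission
  imports Defs
begin

text \<open>
  Write \<open>T = tanh (2 x)\<close>, so that \<open>Q' = - T Q\<close>, \<open>Q\<^sup>4 = 3 (1 - T\<^sup>2)\<close> and \<open>Q'' = Q - Q\<^sup>5\<close>. Since the soliton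
  has energy zero and the mass constraint says \<open>2 (\<epsilon>, Q) = - \<parallel>\<epsilon>\<parallel>\<^sup>2\<close>, the energy of \<open>Q + \<epsilon>\<close> is at least
  \<open>1/2 (\<parallel>\<epsilon>'\<parallel>\<^sup>2 + \<parallel>\<epsilon>\<parallel>\<^sup>2 - 5 \<integral> Q\<^sup>4 \<bar>\<epsilon>\<bar>\<^sup>2)\<close> up to terms of higher order, which
  \<open>\<parallel>\<epsilon>\<parallel>\<^sub>\<infinity>\<^sup>2 \<le> 2 \<parallel>\<epsilon>\<parallel> \<parallel>\<epsilon>\<parallel>\<^sub>H\<^sub>1\<close> bounds by \<open>O(\<delta>) \<parallel>\<epsilon>\<parallel>\<^sub>H\<^sub>1\<^sup>2\<close>.

  It remains to see that \<open>\<parallel>f'\<parallel>\<^sup>2 \<ge> 5 \<integral> Q\<^sup>4 f\<^sup>2\<close> for even real \<open>f\<close> orthogonal to \<open>Q\<^sup>3\<close>. The operator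
  \<open>- \<partial>\<^sup>2 + 9 - 5 Q\<^sup>4\<close> factors as \<open>A\<^sup>* A\<close> with \<open>A = \<partial> + 3 T\<close>, whose kernel is spanned by \<open>Q\<^sup>3\<close>. By
  orthogonality and evenness, \<open>h = - Q\<^sup>-\<^sup>3 \<integral>\<^sub>0\<^sup>x Q\<^sup>3 f\<close> solves \<open>A\<^sup>* h = f\<close> on the half line, vanishes at \<open>0\<close> and
  decays at infinity. Integrating an identity that writes \<open>f'\<^sup>2 - 5 Q\<^sup>4 f\<^sup>2\<close> as squares in \<open>f'\<close>, \<open>f\<close>, \<open>h\<close>
  plus an exact derivative gives the inequality on each half line.
\<close>

subsection \<open>Primitives of integrable functions\<close>

text \<open>A weak derivative is merely integrable, so differentiability is replaced by the integral
  identity from the left endpoint: \<open>u\<close> is absolutely continuous and \<open>u'\<close>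
  matters only up to null sets. For \<open>b < a\<close> the condition is vacuous.\<close>

definition primitive_on :: "real \<Rightarrow> real \<Rightarrow> (real \<Rightarrow> real) \<Rightarrow> (real \<Rightarrow> real) \<Rightarrow> bool" where
  "primitive_on a b u u' \<longleftrightarrow> set_integrable lborel {a..b} u' \<and>
     (\<forall>x\<in>{a..b}. (LINT t:{a..x}|lborel. u' t) = u x - u a)"

lemma primitive_onD:
  assumes "primitive_on a b u u'"
  shows "set_integrable lborel {a..b} u'"
    and "a \<le> x \<Longrightarrow> x \<le> b \<Longrightarrow> (LINT t:{a..x}|lborel. u' t) = u x - u a"
  using assms by (auto simp: primitive_on_def)

lemma primitive_on_FTC:
  assumes ab: "a \<le> b"
    and D: "\<And>x. \<lbrakk>a \<le> x; x \<le> b\<rbrakk> \<Longrightarrow> (u has_real_derivative u' x) (at x)"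
    and C: "continuous_on {a..b} u'"
  shows "primitive_on a b u u'"
  unfolding primitive_on_def
proof safe
  show "set_integrable lborel {a..b} u'"
    using C by (rule borel_integrable_atLeastAtMost')
  fix x assume x: "x \<in> {a..b}"
  show "(LINT t:{a..x}|lborel. u' t) = u x - u a"
    unfolding set_lebesgue_integral_def
    using x D C
    by (intro integral_FTC_atLeastAtMost)
      (auto intro: has_field_derivative_at_within continuous_on_subset
        simp flip: has_real_derivative_iff_has_vector_derivative)
qed

lemma primitive_on_real_FTC:
  assumes "\<And>x. (u has_real_derivative u' x) (at x)" "continuous_on UNIV u'"
  shows "a \<le> b \<Longrightarrow> primitive_on a b u u'"
  using assms by (intro primitive_on_FTC) (auto intro: continuous_on_subset)

lemma primitive_on_continuous:
  assumes "primitive_on a b u u'"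
  shows "continuous_on {a..b} u"
proof -
  have I: "set_integrable lborel {a..b} u'" using assms by (simp add: primitive_on_def)
  have eq: "u x = u a + integral {a..x} u'" if "x \<in> {a..b}" for x
  proof -
    have "set_integrable lborel {a..x} u'"
      by (rule set_integrable_subset[OF I]) (use that in auto)
    then show ?thesis
      using primitive_onD(2)[OF assms, of x] that set_borel_integral_eq_integral(2)[of "{a..x}" u']
      by simp
  qed
  have "continuous_on {a..b} (\<lambda>x. u a + integral {a..x} u')"
    by (intro continuous_intros indefinite_integral_continuous_1 set_borel_integral_eq_integral I)
  then show ?thesis
    by (rule continuous_on_cong[THEN iffD1, rotated -1]) (simp_all only: eq)
qed

lemma set_integral_Icc_combine:
  fixes f :: "real \<Rightarrow> real"
  assumes "set_integrable lborel {a..b} f" "a \<le> c" "c \<le> b"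
  shows "(LINT t:{a..b}|lborel. f t) = (LINT t:{a..c}|lborel. f t) + (LINT t:{c..b}|lborel. f t)"
proof -
  have 1: "set_integrable lborel {a..c} f" "set_integrable lborel {c..b} f"
    by (rule set_integrable_subset[OF assms(1)]; use assms(2,3) in auto)+
  show ?thesis
    using Henstock_Kurzweil_Integration.integral_combine[OF assms(2,3) set_borel_integral_eq_integral(1)[OF assms(1)]]
    by (simp add: set_borel_integral_eq_integral(2) assms(1) 1)
qed

lemma primitive_on_diff:
  assumes "primitive_on a b u u'" "a \<le> c" "c \<le> d" "d \<le> b"
  shows "u d - u c = (LINT t:{c..d}|lborel. u' t)"
proof -
  have "set_integrable lborel {a..d} u'"
    by (rule set_integrable_subset[of _ "{a..b}"]) (use assms in \<open>auto simp: primitive_on_def\<close>)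
  from set_integral_Icc_combine[OF this assms(2,3)] show ?thesis
    using assms by (simp add: primitive_on_def)
qed

lemma primitive_on_subset:
  assumes "primitive_on a b u u'" "a \<le> c" "d \<le> b"
  shows "primitive_on c d u u'"
  unfolding primitive_on_def
proof safe
  show "set_integrable lborel {c..d} u'"
    by (rule set_integrable_subset[of _ "{a..b}"]) (use assms in \<open>auto simp: primitive_on_def\<close>)
  fix x assume "x \<in> {c..d}"
  then show "(LINT t:{c..x}|lborel. u' t) = u x - u c"
    using primitive_on_diff[OF assms(1,2), of x] assms(3) by auto
qed

lemma primitive_on_add:
  assumes "primitive_on a b u u'" "primitive_on a b v v'"
  shows "primitive_on a b (\<lambda>x. u x + v x) (\<lambda>x. u' x + v' x)"
  unfolding primitive_on_def
proof safe
  have *: "set_integrable lborel {a..b} u'" "set_integrable lborel {a..b} v'"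
    using assms by (auto simp: primitive_on_def)
  then show "set_integrable lborel {a..b} (\<lambda>x. u' x + v' x)" by simp
  fix x assume x: "x \<in> {a..b}"
  have "set_integrable lborel {a..x} u'" "set_integrable lborel {a..x} v'"
    by (rule set_integrable_subset[of _ "{a..b}"]; use * x in auto)+
  then show "(LINT t:{a..x}|lborel. u' t + v' t) = u x + v x - (u a + v a)"
    using assms x by (simp add: primitive_on_def)
qed

lemma primitive_on_cmult:
  assumes "primitive_on a b u u'"
  shows "primitive_on a b (\<lambda>x. c * u x) (\<lambda>x. c * u' x)"
  using assms by (auto simp: primitive_on_def right_diff_distrib)

lemma primitive_on_cong:
  assumes "primitive_on a b u u'" "\<And>x. x \<in> {a..b} \<Longrightarrow> u x = v x" "\<And>x. x \<in> {a..b} \<Longrightarrow> u' x = v' x"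
  shows "primitive_on a b v v'"
  unfolding primitive_on_def
proof safe
  show "set_integrable lborel {a..b} v'"
    using primitive_onD(1)[OF assms(1)] by (rule set_integrable_cong[THEN iffD1, rotated -1]) (use assms(3) in auto)
  fix x assume x: "x \<in> {a..b}"
  have "(LINT t:{a..x}|lborel. v' t) = (LINT t:{a..x}|lborel. u' t)"
    by (rule set_lebesgue_integral_cong) (use assms(3) x in auto)
  then show "(LINT t:{a..x}|lborel. v' t) = v x - v a"
    using primitive_onD(2)[OF assms(1), of x] assms(2)[of x] assms(2)[of a] x by simp
qed

lemma primitive_on_antimono:
  assumes "primitive_on a b u u'" "a \<le> b" "\<And>x. x \<in> {a..b} \<Longrightarrow> u' x \<le> 0"
  shows "u b \<le> u a"
proof -
  have "0 \<le> (LINT t:{a..b}|lborel. - u' t)"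
    unfolding set_lebesgue_integral_def
    by (rule integral_nonneg_AE) (use assms(3) in \<open>auto simp: indicator_def\<close>)
  also have "\<dots> = - (u b - u a)"
    using primitive_onD[OF assms(1)] assms(2) by (simp add: set_integral_uminus)
  finally show ?thesis by simp
qed

lemma set_integrable_mult_continuous:
  fixes u f :: "real \<Rightarrow> real"
  assumes f: "set_integrable lborel {a..b} f" and u: "continuous_on {a..b} u"
  shows "set_integrable lborel {a..b} (\<lambda>x. u x * f x)"
proof -
  obtain M where M: "\<And>x. x \<in> {a..b} \<Longrightarrow> norm (u x) \<le> M"
    using compact_imp_bounded[OF compact_continuous_image[OF u compact_Icc]]
    by (meson bounded_iff imageI)
  have m1: "(\<lambda>x. indicator {a..b} x *\<^sub>R f x) \<in> borel_measurable lborel"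
    using f by (auto simp: set_integrable_def)
  have m2: "(\<lambda>x. indicator {a..b} x *\<^sub>R u x) \<in> borel_measurable lborel"
    using borel_integrable_compact[OF compact_Icc u] by auto
  have "integrable lborel (\<lambda>x. (indicator {a..b} x *\<^sub>R u x) * (indicator {a..b} x *\<^sub>R f x))"
  proof (rule Bochner_Integration.integrable_bound)
    show "integrable lborel (\<lambda>x. M * (indicator {a..b} x *\<^sub>R f x))"
      using f by (simp add: set_integrable_def)
    show "AE x in lborel. norm (indicator {a..b} x *\<^sub>R u x * indicator {a..b} x *\<^sub>R f x)
             \<le> norm (M * indicator {a..b} x *\<^sub>R f x)"
      using M by (intro AE_I2) (force simp: indicator_def abs_mult intro: mult_right_mono)
  qed (use borel_measurable_times[OF m2 m1] in auto)
  then show ?thesis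
    unfolding set_integrable_def
    by (rule back_subst[of "integrable lborel"]) (auto simp: indicator_def)
qed

lemma continuous_on_primitive:
  assumes "\<And>a b. a \<le> b \<Longrightarrow> primitive_on a b u u'"
  shows "continuous_on UNIV u"
proof -
  have "isCont u x" for x
    using continuous_on_interior[OF primitive_on_continuous[OF assms[of "x - 1" "x + 1"]], of x]
    by simp
  then show ?thesis by (simp add: continuous_on_eq_continuous_at)
qed

lemma integral_product_triangles:
  fixes \<phi> \<psi> :: "real \<Rightarrow> real"
  assumes \<phi>: "integrable lborel \<phi>" and \<psi>: "integrable lborel \<psi>"
  shows "(LINT s|lborel. \<phi> s) * (LINT t|lborel. \<psi> t) =
    (LINT t|lborel. \<psi> t * (LINT s:{..t}|lborel. \<phi> s)) +
    (LINT s|lborel. \<phi> s * (LINT t:{..s}|lborel. \<psi> t))"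
proof -
  have [measurable]: "\<phi> \<in> borel_measurable borel" "\<psi> \<in> borel_measurable borel"
    using \<phi> \<psi> by (auto dest: borel_measurable_integrable)
  let ?P = "\<lambda>z. \<phi> (fst z) * \<psi> (snd z)"
  have P: "integrable (lborel \<Otimes>\<^sub>M lborel) ?P"
    by (rule lborel_pair.Fubini_integrable)
      (auto simp: abs_mult \<phi> \<psi> intro!: integrable_mult_left integrable_mult_right integrable_abs)
  define A where "A = {z::real \<times> real. fst z \<le> snd z}"
  have [measurable]: "A \<in> sets (lborel \<Otimes>\<^sub>M lborel)" "- A \<in> sets (lborel \<Otimes>\<^sub>M lborel)"
  proof -
    have "{z\<in>space (borel \<Otimes>\<^sub>M borel). fst z \<le> (snd z::real)} \<in> sets (borel \<Otimes>\<^sub>M borel)"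
      by measurable
    then show "A \<in> sets (lborel \<Otimes>\<^sub>M lborel)"
      by (simp add: A_def space_pair_measure sets_pair_measure_cong[OF sets_lborel sets_lborel])
    then show "- A \<in> sets (lborel \<Otimes>\<^sub>M lborel)"
      using sets.compl_sets by (fastforce simp: space_pair_measure Compl_eq_Diff_UNIV)
  qed
  have P1: "integrable (lborel \<Otimes>\<^sub>M lborel) (\<lambda>z. indicator A z *\<^sub>R ?P z)"
    and P2: "integrable (lborel \<Otimes>\<^sub>M lborel) (\<lambda>z. indicator (- A) z *\<^sub>R ?P z)"
    by (rule integrable_mult_indicator[OF _ P]; measurable)+
  have "(LINT z|(lborel \<Otimes>\<^sub>M lborel). ?P z) = (LINT s|lborel. \<phi> s) * (LINT t|lborel. \<psi> t)"
    using lborel_pair.integral_fst'[OF P] by simp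
  moreover have "(LINT z|(lborel \<Otimes>\<^sub>M lborel). indicator A z *\<^sub>R ?P z) =
      (LINT t|lborel. \<psi> t * (LINT s:{..t}|lborel. \<phi> s))"
  proof -
    have "(LINT z|(lborel \<Otimes>\<^sub>M lborel). indicator A z *\<^sub>R ?P z) =
       (LINT t|lborel. LINT s|lborel. indicator A (s,t) *\<^sub>R ?P (s,t))"
      using lborel_pair.integral_snd[of "\<lambda>s t. indicator A (s,t) *\<^sub>R ?P (s,t)"] P1 by (simp add: case_prod_unfold)
    also have "\<dots> = (LINT t|lborel. LINT s|lborel. \<psi> t * (indicator {..t} s *\<^sub>R \<phi> s))"
      by (intro Bochner_Integration.integral_cong) (auto simp: A_def indicator_def)
    finally show ?thesis by (simp add: set_lebesgue_integral_def)
  qed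
  moreover have "(LINT z|(lborel \<Otimes>\<^sub>M lborel). indicator (-A) z *\<^sub>R ?P z) =
      (LINT s|lborel. \<phi> s * (LINT t:{..s}|lborel. \<psi> t))"
  proof -
    have "(LINT z|(lborel \<Otimes>\<^sub>M lborel). indicator (-A) z *\<^sub>R ?P z) =
       (LINT s|lborel. LINT t|lborel. indicator (-A) (s,t) *\<^sub>R ?P (s,t))"
      using lborel_pair.integral_fst'[OF P2] by simp
    also have "\<dots> = (LINT s|lborel. LINT t|lborel. \<phi> s * (indicator {..<s} t *\<^sub>R \<psi> t))"
      by (intro Bochner_Integration.integral_cong) (auto simp: A_def indicator_def)
    \<comment> \<open>The strict triangle may be closed, since in each slice the diagonal is a
      single point.\<close>
    also have "\<dots> = (LINT s|lborel. LINT t|lborel. \<phi> s * (indicator {..s} t *\<^sub>R \<psi> t))"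
    proof (rule Bochner_Integration.integral_cong[OF refl], rule integral_cong_AE)
      fix s :: real
      show "AE t in lborel. \<phi> s * indicat_real {..<s} t *\<^sub>R \<psi> t = \<phi> s * indicat_real {..s} t *\<^sub>R \<psi> t"
        using AE_lborel_singleton[of s] by eventually_elim (auto simp: indicator_def)
    qed auto
    finally show ?thesis by (simp add: set_lebesgue_integral_def)
  qed
  moreover have "(LINT z|(lborel \<Otimes>\<^sub>M lborel). ?P z) = (LINT z|(lborel \<Otimes>\<^sub>M lborel). indicator A z *\<^sub>R ?P z)
     + (LINT z|(lborel \<Otimes>\<^sub>M lborel). indicator (-A) z *\<^sub>R ?P z)"
    unfolding Bochner_Integration.integral_add[OF P1 P2, symmetric]
    by (auto intro!: Bochner_Integration.integral_cong simp: indicator_def)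
  ultimately show ?thesis by simp
qed

text \<open>With both derivatives cut off to \<open>{a..x}\<close>, the triangle identity expands
  the product of the increments of \<open>u\<close> and \<open>v\<close>; the constants
  \<open>u a\<close> and \<open>v a\<close> inside the inner integrals supply the remaining
  terms.\<close>

lemma primitive_on_mult:
  assumes u: "primitive_on a b u u'" and v: "primitive_on a b v v'"
  shows "primitive_on a b (\<lambda>x. u x * v x) (\<lambda>x. u' x * v x + u x * v' x)"
  unfolding primitive_on_def
proof safe
  have I: "set_integrable lborel {a..b} (\<lambda>x. v x * u' x)" "set_integrable lborel {a..b} (\<lambda>x. u x * v' x)"
    using u v by (auto intro!: set_integrable_mult_continuous primitive_on_continuous
        simp: primitive_on_def)
  then show "set_integrable lborel {a..b} (\<lambda>x. u' x * v x + u x * v' x)"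
    by (simp add: mult.commute)
  fix x assume x: "x \<in> {a..b}"
  have I': "set_integrable lborel {a..x} (\<lambda>x. v x * u' x)" "set_integrable lborel {a..x} (\<lambda>x. u x * v' x)"
    by (rule set_integrable_subset[of _ "{a..b}"]; use x I in auto)+
  have J: "set_integrable lborel {a..x} u'" "set_integrable lborel {a..x} v'"
    by (rule set_integrable_subset[of _ "{a..b}"]; use x u v in \<open>auto simp: primitive_on_def\<close>)+
  define \<phi> \<psi> where "\<phi> = (\<lambda>s. indicator {a..x} s *\<^sub>R u' s)" and "\<psi> = (\<lambda>s. indicator {a..x} s *\<^sub>R v' s)"
  have \<phi>: "integrable lborel \<phi>" and \<psi>: "integrable lborel \<psi>"
    using J by (auto simp: \<phi>_def \<psi>_def set_integrable_def)
  have inner: "(LINT s:{..t}|lborel. indicator {a..x} s *\<^sub>R w' s) = w t - w a"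
    if "primitive_on a b w w'" "t \<in> {a..x}" for w w' t
  proof -
    have "(LINT s:{..t}|lborel. indicator {a..x} s *\<^sub>R w' s) = (LINT s:{a..t}|lborel. w' s)"
      unfolding set_lebesgue_integral_def using that(2)
      by (intro Bochner_Integration.integral_cong) (auto simp: indicator_def)
    then show ?thesis using that x by (simp add: primitive_on_def)
  qed
  have \<phi>_int: "(LINT s:{..t}|lborel. \<phi> s) = u t - u a" if "t \<in> {a..x}" for t
    unfolding \<phi>_def using u that by (rule inner)
  have \<psi>_int: "(LINT s:{..t}|lborel. \<psi> s) = v t - v a" if "t \<in> {a..x}" for t
    unfolding \<psi>_def using v that by (rule inner)
  have "(u x - u a) * (v x - v a) = (LINT s|lborel. \<phi> s) * (LINT t|lborel. \<psi> t)"
    using u v x by (simp add: primitive_on_def \<phi>_def \<psi>_def set_lebesgue_integral_def)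
  also have "\<dots> = (LINT t|lborel. \<psi> t * (LINT s:{..t}|lborel. \<phi> s)) +
    (LINT s|lborel. \<phi> s * (LINT t:{..s}|lborel. \<psi> t))"
    by (rule integral_product_triangles[OF \<phi> \<psi>])
  also have "(LINT t|lborel. \<psi> t * (LINT s:{..t}|lborel. \<phi> s)) = (LINT t:{a..x}|lborel. u t * v' t - u a * v' t)"
    unfolding set_lebesgue_integral_def[of _ "{a..x}"]
  proof (intro Bochner_Integration.integral_cong refl)
    fix t show "\<psi> t * (LINT s:{..t}|lborel. \<phi> s) = indicat_real {a..x} t *\<^sub>R (u t * v' t - u a * v' t)"
      by (cases "t \<in> {a..x}") (simp_all add: \<phi>_int \<psi>_def algebra_simps del: atLeastAtMost_iff)
  qed
  also have "\<dots> = (LINT t:{a..x}|lborel. u t * v' t) - u a * (v x - v a)"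
    using I' J v x by (simp add: primitive_on_def)
  also have "(LINT t|lborel. \<phi> t * (LINT s:{..t}|lborel. \<psi> s)) = (LINT t:{a..x}|lborel. v t * u' t - v a * u' t)"
    unfolding set_lebesgue_integral_def[of _ "{a..x}"]
  proof (intro Bochner_Integration.integral_cong refl)
    fix t show "\<phi> t * (LINT s:{..t}|lborel. \<psi> s) = indicat_real {a..x} t *\<^sub>R (v t * u' t - v a * u' t)"
      by (cases "t \<in> {a..x}") (simp_all add: \<psi>_int \<phi>_def algebra_simps del: atLeastAtMost_iff)
  qed
  also have "\<dots> = (LINT t:{a..x}|lborel. v t * u' t) - v a * (u x - u a)"
    using I' J u x by (simp add: primitive_on_def)
  finally show "(LINT t:{a..x}|lborel. u' t * v t + u t * v' t) = u x * v x - u a * v a"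
    using I' by (simp add: algebra_simps)
qed

text \<open>Carries the left half line to the right one, so that estimates at infinity are proved
  only along \<open>at_top\<close>.\<close>

lemma primitive_on_reflect:
  assumes "primitive_on (-b) (-a) u u'" "a \<le> b"
  shows "primitive_on a b (\<lambda>x. u (- x)) (\<lambda>x. - u' (- x))"
proof -
  have I: "set_integrable lborel {-b..-a} u'" by (rule primitive_onD[OF assms(1)])
  have int: "(LINT t:{a..x}|lborel. u' (- t)) = (LINT t:{-x..-a}|lborel. u' t)" for x
    unfolding set_lebesgue_integral_def
    by (subst (2) lborel_integral_real_affine[of "-1" _ 0])
      (auto intro!: Bochner_Integration.integral_cong simp: indicator_def)
  show ?thesis
    unfolding primitive_on_def
  proof safe
    have "integrable lborel (\<lambda>x. indicator {-b..-a} (0 + (-1) * x) *\<^sub>R u' (0 + (-1) * x))"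
      using I unfolding set_integrable_def by (rule lborel_integrable_real_affine) simp
    then have "integrable lborel (\<lambda>x. - (indicator {a..b} x *\<^sub>R u' (- x)))"
      by (intro Bochner_Integration.integrable_minus)
        (rule back_subst[of "integrable lborel"], auto simp: indicator_def fun_eq_iff)
    then show "set_integrable lborel {a..b} (\<lambda>x. - u' (- x))"
      by (simp add: set_integrable_def)
    fix x assume x: "x \<in> {a..b}"
    have "(LINT t:{a..x}|lborel. - u' (- t)) = - (LINT t:{-x..-a}|lborel. u' t)"
      using int[of x] by (simp add: set_lebesgue_integral_def)
    also have "\<dots> = u (- x) - u (- a)"
      using primitive_on_diff[OF assms(1), of "-x" "-a"] x by auto
    finally show "(LINT t:{a..x}|lborel. - u' (- t)) = u (- x) - u (- a)" .
  qed
qed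

subsection \<open>Integrals over the line\<close>

lemma tendsto_set_integral_atLeast:
  fixes f :: "real \<Rightarrow> real"
  assumes "integrable lborel f"
  shows "((\<lambda>n. LINT x:{c..n}|lborel. f x) \<longlongrightarrow> (LINT x:{c..}|lborel. f x)) at_top"
proof -
  have "integrable lborel (\<lambda>x. indicator {c..} x *\<^sub>R f x)"
    by (rule integrable_mult_indicator[OF _ assms]) auto
  from tendsto_integral_at_top[OF _ this] show ?thesis
    unfolding set_lebesgue_integral_def
    by (rule back_subst[of "\<lambda>g. (g \<longlongrightarrow> _) at_top"])
      (auto simp: fun_eq_iff indicator_def intro!: Bochner_Integration.integral_cong)
qed

lemma integral_split_reflect:
  fixes G :: "real \<Rightarrow> real"
  assumes G: "integrable lborel G"
  shows "(LINT x|lborel. G x) = (LINT x:{0..}|lborel. G x) + (LINT x:{0..}|lborel. G (- x))"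
proof -
  have "(LINT x:{0..}|lborel. G (- x)) = (LINT x:{..0}|lborel. G x)"
    unfolding set_lebesgue_integral_def
    by (subst (2) lborel_integral_real_affine[of "-1" _ 0])
      (auto intro!: Bochner_Integration.integral_cong simp: indicator_def)
  moreover have "(LINT x:{0..} \<union> {..0}|lborel. G x) = (LINT x:{0..}|lborel. G x) + (LINT x:{..0}|lborel. G x)"
  proof (rule set_integral_Un_AE)
    show "AE x in lborel. \<not> (x \<in> {0..} \<and> x \<in> {..(0::real)})"
      using AE_lborel_singleton[of "0::real"] by eventually_elim auto
  qed (use G in \<open>auto simp: set_integrable_def intro!: integrable_mult_indicator[of _ lborel G, simplified]\<close>)
  moreover have "{0..} \<union> {..0} = (UNIV::real set)" by auto
  ultimately show ?thesis by (simp add: set_lebesgue_integral_def)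
qed

lemma abs_ge_half_if_close:
  fixes L y :: real
  assumes "\<bar>y - L\<bar> < \<bar>L\<bar> / 2"
  shows "\<bar>L\<bar> / 2 \<le> \<bar>y\<bar>"
  using assms by linarith

text \<open>A nonzero limit would keep the modulus of \<open>F\<close> above half of
  \<open>\<bar>L\<bar>\<close> on arbitrarily long intervals, more than its finite integral
  allows.\<close>

lemma integrable_imp_limit_zero_at_top:
  fixes F :: "real \<Rightarrow> real"
  assumes F: "integrable lborel F" and L: "(F \<longlongrightarrow> L) at_top"
  shows "L = 0"
proof (rule ccontr)
  assume "L \<noteq> 0"
  then have "eventually (\<lambda>x. dist (F x) L < \<bar>L\<bar> / 2) at_top"
    using L by (intro tendstoD) auto
  then obtain c where c: "\<And>x. x \<ge> c \<Longrightarrow> \<bar>F x\<bar> \<ge> \<bar>L\<bar> / 2"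
    unfolding eventually_at_top_linorder dist_real_def
    by (metis (no_types, opaque_lifting) abs_ge_half_if_close)
  define I where "I = (LINT x|lborel. \<bar>F x\<bar>)"
  have bound: "(\<bar>L\<bar> / 2) * t \<le> I" if "t \<ge> 0" for t
  proof -
    have "(LINT x|lborel. indicator {c..c+t} x * (\<bar>L\<bar> / 2)) \<le> I"
      unfolding I_def
      by (rule integral_mono') (use F c in \<open>auto simp: indicator_def\<close>)
    then show ?thesis using that by (simp add: mult.commute)
  qed
  \<comment> \<open>This length makes the left side equal to \<open>I + \<bar>L\<bar> / 2\<close>,
    which exceeds \<open>I\<close>.\<close>
  have "(\<bar>L\<bar> / 2) * ((2 * I + \<bar>L\<bar>) / \<bar>L\<bar>) \<le> I"
    by (rule bound) (simp add: I_def)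
  then show False using \<open>L \<noteq> 0\<close> by (simp add: field_simps) (smt (verit) mult_eq_0_iff zero_le_square)
qed

text \<open>Integrability of \<open>G\<close> makes \<open>F\<close> converge at infinity, and
  integrability of \<open>F\<close> then forces the limit to be 0. All boundary terms at infinity
  are discarded through this fact.\<close>

lemma primitive_tail:
  fixes F G :: "real \<Rightarrow> real"
  assumes F: "integrable lborel F" and G: "integrable lborel G"
    and FG: "\<And>b. c \<le> b \<Longrightarrow> primitive_on c b F G"
  shows primitive_tendsto_zero: "(F \<longlongrightarrow> 0) at_top"
    and primitive_tail_integral: "F c = - (LINT x:{c..}|lborel. G x)"
proof -
  have "((\<lambda>n. F c + (LINT x:{c..n}|lborel. G x)) \<longlongrightarrow> F c + (LINT x:{c..}|lborel. G x)) at_top"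
    by (intro tendsto_intros tendsto_set_integral_atLeast G)
  moreover have "eventually (\<lambda>n. F c + (LINT x:{c..n}|lborel. G x) = F n) at_top"
    using eventually_ge_at_top[of c] by eventually_elim (simp add: primitive_onD(2)[OF FG])
  ultimately have *: "(F \<longlongrightarrow> F c + (LINT x:{c..}|lborel. G x)) at_top"
    by (simp only: tendsto_cong)
  from integrable_imp_limit_zero_at_top[OF F this] *
  show "(F \<longlongrightarrow> 0) at_top" "F c = - (LINT x:{c..}|lborel. G x)" by auto
qed

text \<open>Each half line contributes the value of \<open>F\<close> at 0, with opposite signs; the
  left one is reached by reflection.\<close>

lemma primitive_integral_zero:
  fixes F G :: "real \<Rightarrow> real"
  assumes F: "integrable lborel F" and G: "integrable lborel G"
    and FG: "\<And>a b. a \<le> b \<Longrightarrow> primitive_on a b F G"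
  shows "(LINT x|lborel. G x) = 0"
proof -
  have r: "integrable lborel (\<lambda>x. F (- x))" "integrable lborel (\<lambda>x. - G (- x))"
    using lborel_integrable_real_affine[OF F, of "-1" 0] lborel_integrable_real_affine[OF G, of "-1" 0]
    by auto
  have "F 0 = - (LINT x:{0..}|lborel. G x)"
    by (rule primitive_tail_integral[OF F G]) (use FG in auto)
  moreover have "F (- 0) = - (LINT x:{0..}|lborel. - G (- x))"
    by (rule primitive_tail_integral[OF r]) (use FG in \<open>auto intro!: primitive_on_reflect\<close>)
  moreover have "(LINT x:{0..}|lborel. - G (- x)) = - (LINT x:{0..}|lborel. G (- x))"
    by (simp add: set_lebesgue_integral_def)
  ultimately show ?thesis
    using integral_split_reflect[OF G] by simp
qed

section \<open>Integrability criteria and null sets\<close>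

lemma integrable_product_L2:
  fixes f g :: "real \<Rightarrow> real"
  assumes [measurable]: "f \<in> borel_measurable borel" "g \<in> borel_measurable borel"
    and "integrable lborel (\<lambda>x. (f x)^2)" "integrable lborel (\<lambda>x. (g x)^2)"
  shows "integrable lborel (\<lambda>x. f x * g x)"
proof (rule Bochner_Integration.integrable_bound)
  show "integrable lborel (\<lambda>x. (f x)^2 + (g x)^2)" using assms by simp
  have "\<bar>f x * g x\<bar> \<le> \<bar>(f x)\<^sup>2 + (g x)\<^sup>2\<bar>" for x
  proof -
    have "2 * (\<bar>f x\<bar> * \<bar>g x\<bar>) \<le> \<bar>f x\<bar>^2 + \<bar>g x\<bar>^2" using sum_squares_bound[of "\<bar>f x\<bar>" "\<bar>g x\<bar>"] by simp
    moreover have "0 \<le> \<bar>f x\<bar> * \<bar>g x\<bar>" by simp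
    ultimately show ?thesis unfolding abs_mult power2_abs by linarith
  qed
  then show "AE x in lborel. norm (f x * g x) \<le> norm ((f x)\<^sup>2 + (g x)\<^sup>2)" by simp
qed auto

lemma integrable_bounded_mult:
  fixes f g :: "real \<Rightarrow> real"
  assumes [measurable]: "f \<in> borel_measurable borel"
    and "integrable lborel g" "\<And>x. \<bar>f x\<bar> \<le> B"
  shows "integrable lborel (\<lambda>x. f x * g x)"
proof (rule Bochner_Integration.integrable_bound)
  show "integrable lborel (\<lambda>x. B * g x)" using assms by simp
  show "(\<lambda>x. f x * g x) \<in> borel_measurable lborel"
    using borel_measurable_integrable[OF assms(2)] by measurable
  have "\<bar>f x\<bar> * \<bar>g x\<bar> \<le> \<bar>B\<bar> * \<bar>g x\<bar>" for x
    using assms(3)[of x] by (intro mult_right_mono) auto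
  then show "AE x in lborel. norm (f x * g x) \<le> norm (B * g x)" by (simp add: abs_mult)
qed

lemma set_integrable_Icc_if_L2:
  fixes g :: "real \<Rightarrow> complex"
  assumes [measurable]: "g \<in> borel_measurable borel"
    and g2: "integrable lborel (\<lambda>x. (cmod (g x))\<^sup>2)"
  shows "set_integrable lborel {a..b} g"
  unfolding set_integrable_def
proof (rule Bochner_Integration.integrable_bound)
  show "integrable lborel (\<lambda>x. indicator {a..b} x + (cmod (g x))\<^sup>2)"
    using g2 by (intro Bochner_Integration.integrable_add integrable_real_indicator)
      (auto simp: emeasure_lborel_Icc_eq)
  have "cmod (g x) \<le> 1 + (cmod (g x))\<^sup>2" for x
  proof -
    have "2 * cmod (g x) \<le> 1 + (cmod (g x))\<^sup>2"
      using sum_squares_bound[of 1 "cmod (g x)"] by simp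
    with norm_ge_zero[of "g x"] show ?thesis by linarith
  qed
  then show "AE x in lborel. norm (indicator {a..b} x *\<^sub>R g x)
       \<le> norm (indicator {a..b} x + (cmod (g x))\<^sup>2)"
    by (auto simp: indicator_def)
qed auto

lemma AE_lborel_uminus:
  fixes P :: "real \<Rightarrow> bool"
  assumes "Measurable.pred borel P" "AE x in lborel. P x"
  shows "AE x in lborel. P (- x)"
  using AE_borel_affine[of "-1" P 0] assms by simp

text \<open>An integrable majorant for the square of \<open>Q\<close>; the primitive
  \<open>arctan\<close> has finite limits at both ends.\<close>

lemma integrable_inverse_1_plus_square:
  "integrable lborel (\<lambda>x::real. 1 / (1 + x\<^sup>2))"
proof -
  have "set_integrable lborel (einterval (-\<infinity>) \<infinity>) (\<lambda>x::real. 1 / (1 + x\<^sup>2))"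
  proof (rule interval_integral_FTC_nonneg)
    show "(arctan has_real_derivative 1 / (1 + x\<^sup>2)) (at x)" for x
      by (auto intro!: derivative_eq_intros simp: inverse_eq_divide)
    show "((arctan \<circ> real_of_ereal) \<longlongrightarrow> - (pi/2)) (at_right (-\<infinity>))"
      using tendsto_arctan_at_bot by (simp add: ereal_tendsto_simps)
    show "((arctan \<circ> real_of_ereal) \<longlongrightarrow> pi/2) (at_left \<infinity>)"
      using tendsto_arctan_at_top by (simp add: ereal_tendsto_simps)
    have ne: "1 + x\<^sup>2 \<noteq> 0" for x :: real
      using zero_le_power2[of x] by linarith
    show "isCont (\<lambda>x. 1 / (1 + x\<^sup>2)) x" for x :: real
      by (intro continuous_intros ne)
  qed auto
  then show ?thesis by (simp add: set_integrable_def)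
qed

subsection \<open>The soliton\<close>

lemma Q_pos: "Q x > 0"
  by (simp add: Q_def)

lemma Q_pow4_cosh: "Q x ^ 4 = 3 / (cosh (2 * x))\<^sup>2"
proof -
  have "Q x ^ 4 = Q x powr (of_nat 4)"
    by (rule powr_realpow[symmetric]) (rule Q_pos)
  also have "\<dots> = 3 / (cosh (2 * x))\<^sup>2"
    unfolding Q_def powr_powr by simp
  finally show ?thesis .
qed

lemma Q_pow4: "Q x ^ 4 = 3 * (1 - (tanh (2 * x))\<^sup>2)"
proof -
  have "Q x ^ 4 = 3 / (cosh (2 * x))\<^sup>2"
    by (rule Q_pow4_cosh)
  also have "\<dots> = 3 * (1 - (tanh (2 * x))\<^sup>2)"
  proof -
    have "(sinh (2 * x))\<^sup>2 = (cosh (2 * x))\<^sup>2 - 1"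
      by (simp add: cosh_square_eq)
    then show ?thesis
      using cosh_real_pos[of "2 * x"] by (simp add: tanh_def power_divide diff_divide_distrib)
  qed
  finally show ?thesis .
qed

lemma Q_pow5: "Q x ^ 5 = 3 * (1 - (tanh (2 * x))\<^sup>2) * Q x"
proof -
  have "Q x ^ 5 = Q x ^ 4 * Q x" by (simp add: eval_nat_numeral)
  then show ?thesis by (simp add: Q_pow4)
qed

lemma Q_deriv: "(Q has_real_derivative - tanh (2 * x) * Q x) (at x)"
proof -
  have c: "cosh (2 * x) > 0" by (rule cosh_real_pos)
  have Q_alt: "Q = (\<lambda>x. 3 powr (1/4) * cosh (2 * x) powr (- 1/2))"
  proof
    fix x :: real
    have c: "cosh (2 * x) > 0" by (rule cosh_real_pos)
    have "(cosh (2 * x))\<^sup>2 = cosh (2 * x) powr (of_nat 2)"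
      using c by (rule powr_realpow[symmetric])
    then have "((cosh (2 * x))\<^sup>2) powr (1/4) = cosh (2 * x) powr (1/2)"
      by (simp only: powr_powr) simp
    then show "Q x = 3 powr (1/4) * cosh (2 * x) powr (- 1/2)"
      using c by (simp add: Q_def powr_divide powr_minus_divide)
  qed
  have *: "cosh (2 * x) powr - (3 / 2) = cosh (2 * x) powr - (1 / 2) / cosh (2 * x)"
    using c powr_diff[of "cosh (2 * x)" "-1/2" 1] by simp
  show ?thesis
    unfolding Q_alt using c
    by (auto intro!: derivative_eq_intros simp: tanh_def *)
qed

lemma Q_continuous: "continuous_on A Q"
  by (meson DERIV_isCont Q_deriv continuous_at_imp_continuous_on)

lemma Q_measurable [measurable]: "Q \<in> borel_measurable borel"
  using Q_continuous by (rule borel_measurable_continuous_onI)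

text \<open>The maximum is the fourth root of 3; the rounder value 2 keeps the later constants
  integral.\<close>

lemma Q_le: "Q x \<le> 2"
proof (rule power_le_imp_le_base)
  have "Q x ^ 4 \<le> 16"
    using Q_pow4[of x] zero_le_power2[of "tanh (2 * x)"] by argo
  then show "Q x ^ Suc 3 \<le> 2 ^ Suc 3" by simp
qed simp

lemma Q_minus: "Q (- x) = Q x" by (simp add: Q_def)

lemma Q_square_integrable: "integrable lborel (\<lambda>x. (Q x)\<^sup>2)"
proof (rule Bochner_Integration.integrable_bound)
  show "integrable lborel (\<lambda>x::real. 4 * (1 / (1 + x\<^sup>2)))"
    using integrable_inverse_1_plus_square by (rule integrable_mult_right)
  \<comment> \<open>Squaring both sides brings in \<open>Q x ^ 4\<close>, which is rational in
    \<open>cosh\<close>. The quadratic Taylor bound for the exponential gives the growth of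
    \<open>cosh\<close> that is required.\<close>
  have "(Q x)\<^sup>2 \<le> 4 / (1 + x\<^sup>2)" for x
  proof (rule power_le_imp_le_base)
    have "1 + \<bar>2 * x\<bar> + \<bar>2 * x\<bar>\<^sup>2 / 2 \<le> exp \<bar>2 * x\<bar>"
      by (rule exp_lower_Taylor_quadratic) simp
    moreover have "cosh (2 * x) = cosh \<bar>2 * x\<bar>" by (simp add: abs_if)
    ultimately have "1 + x\<^sup>2 \<le> 2 * cosh (2 * x)"
      unfolding cosh_field_def by (simp add: power_mult_distrib)
       (smt (verit) exp_gt_zero zero_le_power2)
    then have *: "(1 + x\<^sup>2)\<^sup>2 \<le> 4 * (cosh (2 * x))\<^sup>2"
      using power_mono[of "1 + x\<^sup>2" "2 * cosh (2 * x)" 2] by (simp add: power_mult_distrib)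
    have p: "0 < (1 + x\<^sup>2)\<^sup>2"
      using zero_le_power2[of x] by (intro zero_less_power) linarith
    have "Q x ^ 4 = 3 / (cosh (2 * x))\<^sup>2"
      by (rule Q_pow4_cosh)
    also have "\<dots> = 12 / (4 * (cosh (2 * x))\<^sup>2)" by simp
    also have "\<dots> \<le> 12 / (1 + x\<^sup>2)\<^sup>2" using * p by (intro divide_left_mono) (auto intro!: mult_pos_pos)
    also have "\<dots> \<le> 16 / (1 + x\<^sup>2)\<^sup>2" using p by (intro divide_right_mono) auto
    finally show "((Q x)\<^sup>2) ^ Suc 1 \<le> (4 / (1 + x\<^sup>2)) ^ Suc 1"
      by (simp add: power_divide power2_eq_square eval_nat_numeral algebra_simps)
  qed (simp add: add_nonneg_nonneg)
  then show "AE x in lborel. norm ((Q x)\<^sup>2) \<le> norm (4 * (1 / (1 + x\<^sup>2)))" by (auto intro: order_trans)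
qed auto

section \<open>The logarithmic derivative of the soliton\<close>

abbreviation T :: "real \<Rightarrow> real" where "T x \<equiv> tanh (2 * x)"

lemma T_bounds: "-1 < T x" "T x < 1" "(T x)\<^sup>2 < 1"
proof -
  show "-1 < T x" "T x < 1" by (rule tanh_real_gt_neg1 tanh_real_lt_1)+
  then show "(T x)\<^sup>2 < 1" by (simp add: abs_square_less_1)
qed

lemma T_deriv: "(T has_real_derivative 2 * (1 - (T x)\<^sup>2)) (at x)"
  using cosh_real_pos[of "2 * x"] by (auto intro!: derivative_eq_intros)

lemma T_continuous: "continuous_on A T"
  by (intro continuous_at_imp_continuous_on ballI DERIV_isCont[OF T_deriv])

lemma T_measurable [measurable]: "T \<in> borel_measurable borel"
  using T_continuous by (rule borel_measurable_continuous_onI)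

lemma T_tendsto: "(T \<longlongrightarrow> 1) at_top"
  by (rule filterlim_compose[OF tanh_real_at_top])
    (intro filterlim_tendsto_pos_mult_at_top[OF tendsto_const] filterlim_ident, simp)

lemma Q_cube_deriv: "((\<lambda>x. Q x ^ 3) has_real_derivative - 3 * T x * Q x ^ 3) (at x)"
  by (rule derivative_eq_intros Q_deriv refl)+ (simp add: eval_nat_numeral)

lemma inverse_Q_cube_deriv:
  "((\<lambda>x. inverse (Q x ^ 3)) has_real_derivative 3 * T x * inverse (Q x ^ 3)) (at x)"
  using Q_pos[of x]
  by (auto intro!: derivative_eq_intros Q_deriv simp: eval_nat_numeral field_simps)

lemma Q_cube_square_integrable: "integrable lborel (\<lambda>x. (Q x ^ 3)\<^sup>2)"
proof -
  have "\<bar>Q x ^ 4\<bar> \<le> 3" for x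
    using Q_pow4[of x] T_bounds(3)[of x] by simp
  from integrable_bounded_mult[OF _ Q_square_integrable this]
  show ?thesis by (simp add: eval_nat_numeral ac_simps)
qed

subsection \<open>Coercivity of the linearized operator on even functions\<close>

text \<open>
  For \<open>w = tanh (2 * (x + \<eta>))\<close> with \<open>tanh (2 * \<eta>) = 1/3\<close> this is \<open>p = - w' / w\<close>, rationally expressed in
  \<open>T\<close>. The shift \<open>\<eta> > 0\<close> keeps it regular at \<open>0\<close>, and \<open>- w'' / w = p' - p\<^sup>2 \<ge> 3 * (1 - T\<^sup>2)\<close>
  on the half line.
\<close>
definition riccati :: "real \<Rightarrow> real" where
  "riccati x = - 16 * (1 - (T x)\<^sup>2) / ((3 + T x) * (3 * T x + 1))"

text \<open>By the addition formula the shifted tangent is \<open>w = (3 * T + 1) / (3 + T)\<close>.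
  The second summand is \<open>8 * (1 - w\<^sup>2)\<close>, which equals \<open>- w'' / w\<close>
  because \<open>w' = 2 * (1 - w\<^sup>2)\<close>. Displaying the Riccati equation in this form
  exposes the remainder \<open>p' - p\<^sup>2\<close>.\<close>

definition riccati' :: "real \<Rightarrow> real" where
  "riccati' x = (riccati x)\<^sup>2 + 64 * (1 - (T x)\<^sup>2) / (3 + T x)\<^sup>2"

lemma riccati_deriv:
  assumes "0 \<le> x"
  shows "(riccati has_real_derivative riccati' x) (at x)"
proof -
  have T: "0 \<le> T x" using assms by simp
  then have [simp]: "3 + T x \<noteq> 0" "3 * T x + 1 \<noteq> 0" by linarith+
  show ?thesis
    unfolding riccati_def[abs_def]
    by (rule derivative_eq_intros T_deriv refl | simp)+
      (simp add: riccati'_def riccati_def divide_simps, algebra)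
qed

lemma primitive_on_riccati: "0 \<le> b \<Longrightarrow> primitive_on 0 b riccati riccati'"
proof (rule primitive_on_FTC)
  have "3 + T x \<noteq> 0" "3 * T x + 1 \<noteq> 0" if "0 \<le> x" for x
    using that tanh_real_nonneg_iff[of "2*x"] by linarith+
  then show "continuous_on {0..b} riccati'"
    unfolding riccati'_def riccati_def
    by (intro continuous_intros T_continuous) auto
qed (auto intro: riccati_deriv)

text \<open>
  The left-hand side is the derivative of \<open>- 3 T f\<^sup>2 + 18 f h - 9 (p + 3 T) h\<^sup>2\<close> along
  \<open>f' = g\<close>, \<open>h' = 3 T h - f\<close>, \<open>T' = 2 (1 - T\<^sup>2)\<close>; the difference to the right-hand side is
  \<open>(g + 3 T f - 9 h)\<^sup>2 + 9 (h' + p h)\<^sup>2 + 9 (p' - p\<^sup>2 - 3 (1 - T\<^sup>2)) h\<^sup>2\<close>.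
\<close>
lemma half_line_completed_squares:
  fixes f g h p p' t :: real
  assumes "p' = p\<^sup>2 + r" "3 * (1 - t\<^sup>2) \<le> r"
  shows "- 3 * (2 * (1 - t\<^sup>2) * (f * f) + t * (g * f + f * g)) + 18 * (g * h + f * (3 * t * h - f))
     - 9 * ((p' + 6 * (1 - t\<^sup>2)) * (h * h) + (p + 3 * t) * ((3 * t * h - f) * h + h * (3 * t * h - f)))
    \<le> g\<^sup>2 - 15 * (1 - t\<^sup>2) * f\<^sup>2"
proof -
  have "0 \<le> (g + 3 * t * f - 9 * h)\<^sup>2 + 9 * (3 * t * h - f + p * h)\<^sup>2 + 9 * (r - 3 * (1 - t\<^sup>2)) * h\<^sup>2"
    using assms(2) by (intro add_nonneg_nonneg mult_nonneg_nonneg) auto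
  also have "\<dots> = g\<^sup>2 - 15 * (1 - t\<^sup>2) * f\<^sup>2 - (- 3 * (2 * (1 - t\<^sup>2) * (f * f) + t * (g * f + f * g)) + 18 * (g * h + f * (3 * t * h - f))
     - 9 * ((p' + 6 * (1 - t\<^sup>2)) * (h * h) + (p + 3 * t) * ((3 * t * h - f) * h + h * (3 * t * h - f))))"
    unfolding assms(1) by algebra
  finally show ?thesis by simp
qed

text \<open>
  Once \<open>T > 2/3\<close> and \<open>\<bar>f\<bar> < e\<close>, both \<open>F + e/2 Q\<^sup>3\<close> and \<open>- F + e/2 Q\<^sup>3\<close> decrease, since
  \<open>(Q\<^sup>3)' = - 3 T Q\<^sup>3\<close>.
\<close>
lemma weighted_tail_small:
  fixes F f :: "real \<Rightarrow> real"
  assumes prim: "\<And>b. 0 \<le> b \<Longrightarrow> primitive_on 0 b F (\<lambda>x. Q x ^ 3 * f x)"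
    and F0: "(F \<longlongrightarrow> 0) at_top" and f0: "(f \<longlongrightarrow> 0) at_top"
  shows "((\<lambda>x. - (F x * inverse (Q x ^ 3))) \<longlongrightarrow> 0) at_top"
proof (rule tendstoI)
  fix e :: real assume e: "0 < e"
  \<comment> \<open>Above 2/3, the decay \<open>e / 2 * 3 * T\<close> of the comparison term beats
    \<open>e\<close>, hence also \<open>\<bar>f\<bar>\<close>.\<close>
  have "eventually (\<lambda>x. dist (f x) 0 < e \<and> 2 / 3 < T x \<and> 0 \<le> x) at_top"
    by (intro eventually_conj tendstoD[OF f0 e] order_tendstoD(1)[OF T_tendsto] eventually_ge_at_top) simp
  then obtain X where X: "\<And>x. X \<le> x \<Longrightarrow> \<bar>f x\<bar> < e \<and> 2 / 3 < T x \<and> 0 \<le> x"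
    by (auto simp: eventually_at_top_linorder)
  \<comment> \<open>The sign \<open>s\<close> treats \<open>F\<close> and \<open>- F\<close>
    together. Monotonicity compares \<open>x\<close> with a later \<open>y\<close>, and letting
    \<open>y\<close> tend to infinity removes \<open>F y\<close>.\<close>
  have bound: "0 \<le> s * F x + e / 2 * Q x ^ 3" if x: "X \<le> x" and s: "\<bar>s\<bar> = 1" for s x
  proof (rule tendsto_upperbound)
    show "((\<lambda>y. s * F y) \<longlongrightarrow> 0) at_top"
      using tendsto_mult_right_zero[OF F0] by simp
    show "eventually (\<lambda>y. s * F y \<le> s * F x + e / 2 * Q x ^ 3) at_top"
      using eventually_ge_at_top[of x]
    proof eventually_elim
      case (elim y)
      have x0: "0 \<le> x" using X x by auto
      have "primitive_on x y (\<lambda>x. s * F x + e / 2 * Q x ^ 3)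
         (\<lambda>x. s * (Q x ^ 3 * f x) + e / 2 * (- 3 * T x * Q x ^ 3))"
        using elim x0
        by (intro primitive_on_add primitive_on_cmult primitive_on_real_FTC Q_cube_deriv
            primitive_on_subset[OF prim[of y]] continuous_intros T_continuous Q_continuous) auto
      then have "s * F y + e / 2 * Q y ^ 3 \<le> s * F x + e / 2 * Q x ^ 3"
      proof (rule primitive_on_antimono[OF _ elim])
        fix z assume "z \<in> {x..y}"
        then have z: "\<bar>f z\<bar> < e" "2 / 3 < T z" using X[of z] x by auto
        have "s * f z \<le> \<bar>f z\<bar>" using s by (metis abs_ge_self abs_mult mult_1)
        moreover have "e * (2 / 3) < e * T z" using z e by simp
        ultimately have "s * f z - 3 / 2 * (e * T z) \<le> 0" using z by linarith
        then have "Q z ^ 3 * (s * f z - 3 / 2 * (e * T z)) \<le> 0"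
          using Q_pos[of z] by (intro mult_nonneg_nonpos) auto
        then show "s * (Q z ^ 3 * f z) + e / 2 * (- 3 * T z * Q z ^ 3) \<le> 0"
          by (simp add: algebra_simps)
      qed
      moreover have "0 \<le> e / 2 * Q y ^ 3" using e Q_pos[of y] by simp
      ultimately show ?case by linarith
    qed
  qed simp
  show "eventually (\<lambda>x. dist (- (F x * inverse (Q x ^ 3))) 0 < e) at_top"
    using eventually_ge_at_top[of X]
  proof eventually_elim
    case (elim x)
    have "\<bar>F x\<bar> \<le> e / 2 * Q x ^ 3"
      using bound[OF elim, of 1] bound[OF elim, of "-1"] by simp
    moreover have "e / 2 * Q x ^ 3 < e * Q x ^ 3" using e Q_pos[of x] by simp
    ultimately show ?case using Q_pos[of x] by (simp add: dist_real_def abs_mult field_simps)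
  qed
qed

text \<open>The boundary form \<open>B\<close> vanishes at 0 because \<open>T\<close> and
  \<open>h\<close> do, and its derivative lies below \<open>G\<close>. So the integral of
  \<open>G\<close> over \<open>{0..b}\<close> is at least \<open>B b\<close>, whose lower bound
  tends to 0 as \<open>f\<close> and \<open>h\<close> decay.\<close>

lemma half_line_inequality:
  fixes f g :: "real \<Rightarrow> real"
  assumes prim: "\<And>a b. a \<le> b \<Longrightarrow> primitive_on a b f g"
    and [measurable]: "f \<in> borel_measurable borel" "g \<in> borel_measurable borel"
    and f2: "integrable lborel (\<lambda>x. (f x)\<^sup>2)" and g2: "integrable lborel (\<lambda>x. (g x)\<^sup>2)"
    and orth: "(LINT x:{0..}|lborel. Q x ^ 3 * f x) = 0"
  shows "0 \<le> (LINT x:{0..}|lborel. (g x)\<^sup>2 - 15 * (1 - (T x)\<^sup>2) * (f x)\<^sup>2)"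
proof -
  have fcont: "continuous_on A f" for A
    using continuous_on_primitive[OF prim] continuous_on_subset by blast
  have fg: "integrable lborel (\<lambda>x. g x * f x + f x * g x)"
    by (intro Bochner_Integration.integrable_add integrable_product_L2 f2 g2) auto
  \<comment> \<open>The square of \<open>f\<close> and its derivative \<open>2 * f * g\<close> are
    both integrable, so decay follows without pointwise control of \<open>g\<close>.\<close>
  have "((\<lambda>x. f x * f x) \<longlongrightarrow> 0) at_top"
  proof (rule primitive_tendsto_zero[OF _ fg])
    show "primitive_on 0 b (\<lambda>x. f x * f x) (\<lambda>x. g x * f x + f x * g x)" if "0 \<le> b" for b
      using that by (intro primitive_on_mult prim)
  qed (use f2 in \<open>simp add: power2_eq_square\<close>)
  then have f0: "(f \<longlongrightarrow> 0) at_top"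
    using tendsto_real_sqrt[of "\<lambda>x. f x * f x" 0 at_top] by (simp add: tendsto_rabs_zero_iff)
  define F where "F x = (LINT t:{0..x}|lborel. Q t ^ 3 * f t)" for x
  have WI: "integrable lborel (\<lambda>x. Q x ^ 3 * f x)"
    by (intro integrable_product_L2 f2 Q_cube_square_integrable) auto
  have F0: "F 0 = 0"
    using interval_integral_Icc[of 0 0 "\<lambda>t. Q t ^ 3 * f t"] by (simp add: F_def)
  have primF: "primitive_on 0 b F (\<lambda>x. Q x ^ 3 * f x)" for b
    unfolding primitive_on_def F0
    using integrable_mult_indicator[OF _ WI, of "{0..b}"] by (auto simp: F_def set_integrable_def)
  \<comment> \<open>Orthogonality enters here: only because \<open>F\<close> tends to 0 can it
    survive division by the decaying weight \<open>Q x ^ 3\<close>.\<close>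
  have Flim: "(F \<longlongrightarrow> 0) at_top"
    using tendsto_set_integral_atLeast[OF WI, of 0] by (simp add: F_def[abs_def] orth)
  define h where "h x = - (F x * inverse (Q x ^ 3))" for x
  have h0: "h 0 = 0" by (simp add: h_def F0)
  have hlim: "(h \<longlongrightarrow> 0) at_top"
    unfolding h_def by (rule weighted_tail_small[OF primF Flim f0])
  have primh: "primitive_on 0 b h (\<lambda>x. 3 * T x * h x - f x)" if "0 \<le> b" for b
  proof -
    have "primitive_on 0 b (\<lambda>x. (- 1) * (F x * inverse (Q x ^ 3)))
      (\<lambda>x. (- 1) * ((Q x ^ 3 * f x) * inverse (Q x ^ 3) + F x * (3 * T x * inverse (Q x ^ 3))))"
      using that Q_pos[THEN less_imp_neq, THEN not_sym]
      by (intro primitive_on_cmult primitive_on_mult primF primitive_on_real_FTC inverse_Q_cube_deriv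
          continuous_intros T_continuous Q_continuous) auto
    then show ?thesis
      by (rule primitive_on_cong)
        (auto simp: h_def field_simps Q_pos[THEN less_imp_neq, THEN not_sym])
  qed
  define B where "B x = - 3 * (T x * (f x * f x)) + 18 * (f x * h x) + (- 9) * ((riccati x + 3 * T x) * (h x * h x))" for x
  define B' where "B' x = - 3 * (2 * (1 - (T x)\<^sup>2) * (f x * f x) + T x * (g x * f x + f x * g x))
     + 18 * (g x * h x + f x * (3 * T x * h x - f x))
     + (- 9) * ((riccati' x + 3 * (2 * (1 - (T x)\<^sup>2))) * (h x * h x) + (riccati x + 3 * T x) *
         ((3 * T x * h x - f x) * h x + h x * (3 * T x * h x - f x)))" for x
  have primB: "primitive_on 0 b B B'" if "0 \<le> b" for b
  proof -
    have pT: "primitive_on 0 b T (\<lambda>x. 2 * (1 - (T x)\<^sup>2))"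
      using that by (intro primitive_on_real_FTC T_deriv continuous_intros T_continuous)
    note pf = prim[OF that] and ph = primh[OF that] and pp = primitive_on_riccati[OF that]
    show ?thesis
      unfolding B_def[abs_def] B'_def[abs_def]
      by (rule primitive_on_add[OF primitive_on_add[OF
            primitive_on_cmult[OF primitive_on_mult[OF pT primitive_on_mult[OF pf pf]], of "- 3"]
            primitive_on_cmult[OF primitive_on_mult[OF pf ph], of 18]]
            primitive_on_cmult[OF primitive_on_mult[OF primitive_on_add[OF pp
              primitive_on_cmult[OF pT, of 3]] primitive_on_mult[OF ph ph]], of "- 9"]])
  qed
  define G where "G x = (g x)\<^sup>2 - 15 * (1 - (T x)\<^sup>2) * (f x)\<^sup>2" for x
  have GI: "integrable lborel G"
  proof -
    have "\<bar>15 * (1 - (T x)\<^sup>2)\<bar> \<le> 15" for x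
      using T_bounds(3)[of x] by (auto simp: abs_if)
    from integrable_bounded_mult[OF _ f2 this] show ?thesis
      unfolding G_def by (intro Bochner_Integration.integrable_diff g2) auto
  qed
  have B'_le: "B' x \<le> G x" if "0 \<le> x" for x
  proof -
    have T: "0 \<le> T x" "T x < 1" using that T_bounds by auto
    have "(3 + T x)\<^sup>2 \<le> 4\<^sup>2" using T by (intro power_mono) auto
    then have "4 * (1 - (T x)\<^sup>2) * (3 + T x)\<^sup>2 \<le> 4 * (1 - (T x)\<^sup>2) * 4\<^sup>2"
      using T_bounds(3)[of x] by (intro mult_left_mono) auto
    then have "4 * (1 - (T x)\<^sup>2) \<le> 64 * (1 - (T x)\<^sup>2) / (3 + T x)\<^sup>2"
      using pos_le_divide_eq[of "(3 + T x)\<^sup>2"] T by simp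
    moreover have "3 * (1 - (T x)\<^sup>2) \<le> 4 * (1 - (T x)\<^sup>2)"
      using T_bounds(3)[of x] by simp
    ultimately have r: "3 * (1 - (T x)\<^sup>2) \<le> 64 * (1 - (T x)\<^sup>2) / (3 + T x)\<^sup>2"
      by (rule order_trans[rotated])
    from half_line_completed_squares[OF riccati'_def[of x] r, of "f x" "g x" "h x"]
    show ?thesis unfolding B'_def G_def by simp
  qed
  have lower: "- 3 * (f b * f b) - 18 * \<bar>f b * h b\<bar> - 27 * (h b * h b) \<le> (LINT x:{0..b}|lborel. G x)"
    if b: "0 \<le> b" for b
  proof -
    have T: "0 \<le> T b" "T b < 1" using b T_bounds by auto
    \<comment> \<open>As \<open>h\<^sup>2\<close> carries the factor -9 in \<open>B\<close>, an
      upper bound for \<open>p + 3 * T\<close> suffices: \<open>p \<le> 0\<close> and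
      \<open>T < 1\<close> give 3, whence the coefficient 27.\<close>
    have "riccati b \<le> 0"
      unfolding riccati_def using T T_bounds(3)[of b] by (intro divide_nonpos_nonneg) auto
    then have "(riccati b + 3 * T b) * (h b * h b) \<le> 3 * (h b * h b)"
      using T by (intro mult_right_mono) auto
    moreover have "T b * (f b * f b) \<le> 1 * (f b * f b)"
      using T by (intro mult_right_mono) auto
    ultimately have "- 3 * (f b * f b) - 18 * \<bar>f b * h b\<bar> - 27 * (h b * h b) \<le> B b"
      unfolding B_def by linarith
    also have "\<dots> = (LINT x:{0..b}|lborel. B' x)"
      using primitive_onD(2)[OF primB[OF b], of b] b by (simp add: B_def h0)
    also have "\<dots> \<le> (LINT x:{0..b}|lborel. G x)"
      using primitive_onD(1)[OF primB[OF b]] integrable_mult_indicator[OF _ GI, of "{0..b}"] B'_le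
      by (intro set_integral_mono) (auto simp: set_integrable_def)
    finally show ?thesis .
  qed
  have "0 \<le> (LINT x:{0..}|lborel. G x)"
  proof (rule tendsto_le[OF trivial_limit_at_top_linorder tendsto_set_integral_atLeast[OF GI]])
    have "((\<lambda>b. - 3 * (f b * f b) - 18 * \<bar>f b * h b\<bar> - 27 * (h b * h b)) \<longlongrightarrow>
        - 3 * (0 * 0) - 18 * \<bar>0 * 0\<bar> - 27 * (0 * 0)) at_top"
      by (intro tendsto_intros f0 hlim)
    then show "((\<lambda>b. - 3 * (f b * f b) - 18 * \<bar>f b * h b\<bar> - 27 * (h b * h b)) \<longlongrightarrow> 0) at_top"
      by simp
    show "eventually (\<lambda>b. - 3 * (f b * f b) - 18 * \<bar>f b * h b\<bar> - 27 * (h b * h b)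
        \<le> (LINT x:{0..b}|lborel. G x)) at_top"
      using eventually_ge_at_top[of 0] by eventually_elim (rule lower)
  qed
  then show ?thesis by (simp add: G_def)
qed

text \<open>Evenness makes the two half-line integrals of \<open>Q x ^ 3 * f x\<close> equal, so
  orthogonality on the line gives it on each half. The half-line inequality then applies to
  \<open>f\<close> and to its reflection.\<close>

lemma even_coercivity:
  fixes f g :: "real \<Rightarrow> real"
  assumes prim: "\<And>a b. a \<le> b \<Longrightarrow> primitive_on a b f g"
    and m [measurable]: "f \<in> borel_measurable borel" "g \<in> borel_measurable borel"
    and f2: "integrable lborel (\<lambda>x. (f x)\<^sup>2)" and g2: "integrable lborel (\<lambda>x. (g x)\<^sup>2)"
    and even: "AE x in lborel. f (- x) = f x"
    and orth: "(LINT x|lborel. Q x ^ 3 * f x) = 0"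
  shows "(LINT x|lborel. 5 * (Q x ^ 4 * (f x)\<^sup>2)) \<le> (LINT x|lborel. (g x)\<^sup>2)"
proof -
  have WI: "integrable lborel (\<lambda>x. Q x ^ 3 * f x)"
    by (intro integrable_product_L2 f2 Q_cube_square_integrable) auto
  have same: "(LINT x:{0..}|lborel. Q (- x) ^ 3 * f (- x)) = (LINT x:{0..}|lborel. Q x ^ 3 * f x)"
    unfolding set_lebesgue_integral_def Q_minus
    by (rule integral_cong_AE) (use even in \<open>auto elim!: eventually_mono\<close>)
  have orth1: "(LINT x:{0..}|lborel. Q x ^ 3 * f x) = 0"
    using integral_split_reflect[OF WI] orth same by simp
  have orth2: "(LINT x:{0..}|lborel. Q x ^ 3 * f (- x)) = 0"
    using same orth1 by (simp add: Q_minus)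
  have GI: "integrable lborel (\<lambda>x. 15 * (1 - (T x)\<^sup>2) * (f x)\<^sup>2)"
  proof -
    have "\<bar>15 * (1 - (T x)\<^sup>2)\<bar> \<le> 15" for x
      using T_bounds(3)[of x] by (auto simp: abs_if)
    from integrable_bounded_mult[OF _ f2 this] show ?thesis by simp
  qed
  have "0 \<le> (LINT x:{0..}|lborel. (g x)\<^sup>2 - 15 * (1 - (T x)\<^sup>2) * (f x)\<^sup>2)"
    by (rule half_line_inequality[OF prim m f2 g2 orth1])
  moreover have "0 \<le> (LINT x:{0..}|lborel. (- g (- x))\<^sup>2 - 15 * (1 - (T x)\<^sup>2) * (f (- x))\<^sup>2)"
    by (rule half_line_inequality[OF primitive_on_reflect[OF prim] _ _ _ _ orth2])
      (use lborel_integrable_real_affine[OF f2, of "-1" 0] lborel_integrable_real_affine[OF g2, of "-1" 0] in auto)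
  ultimately have "0 \<le> (LINT x|lborel. (g x)\<^sup>2 - 15 * (1 - (T x)\<^sup>2) * (f x)\<^sup>2)"
    using integral_split_reflect[OF Bochner_Integration.integrable_diff[OF g2 GI]] by simp
  also have "\<dots> = (LINT x|lborel. (g x)\<^sup>2) - (LINT x|lborel. 15 * (1 - (T x)\<^sup>2) * (f x)\<^sup>2)"
    by (rule Bochner_Integration.integral_diff[OF g2 GI])
  also have "(LINT x|lborel. 15 * (1 - (T x)\<^sup>2) * (f x)\<^sup>2) = (LINT x|lborel. 5 * (Q x ^ 4 * (f x)\<^sup>2))"
    by (rule Bochner_Integration.integral_cong) (simp_all add: Q_pow4)
  finally show ?thesis by simp
qed

section \<open>The soliton equation in weak form and the energy of the soliton\<close>

lemma Q'_square_integrable: "integrable lborel (\<lambda>x. (- T x * Q x)\<^sup>2)"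
proof -
  have "\<bar>(T x)\<^sup>2\<bar> \<le> 1" for x using T_bounds(3)[of x] by simp
  from integrable_bounded_mult[OF _ Q_square_integrable this]
  show ?thesis by (simp add: power_mult_distrib)
qed

text \<open>The function is \<open>(3 * T\<^sup>2 - 2) * Q\<close>, a bounded multiple of
  \<open>Q\<close>.\<close>

lemma Q''_square_integrable: "integrable lborel (\<lambda>x. (Q x - Q x ^ 5)\<^sup>2)"
proof -
  have "\<bar>(3 * (T x)\<^sup>2 - 2)\<^sup>2\<bar> \<le> 4" for x
  proof -
    have "\<bar>3 * (T x)\<^sup>2 - 2\<bar> \<le> 2" using T_bounds(3)[of x] by (simp add: abs_le_iff)
    from power_mono[OF this abs_ge_zero, of 2] show ?thesis by simp
  qed
  from integrable_bounded_mult[OF _ Q_square_integrable this]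
  have "integrable lborel (\<lambda>x. ((3 * (T x)\<^sup>2 - 2) * Q x)\<^sup>2)" by (simp add: power_mult_distrib)
  moreover have "(3 * (T x)\<^sup>2 - 2) * Q x = Q x - Q x ^ 5" for x
    unfolding Q_pow5 by (simp add: algebra_simps)
  ultimately show ?thesis by simp
qed

text \<open>This is the equation \<open>Q'' = Q - Q ^ 5\<close> tested against \<open>f\<close>. No
  boundary terms remain, since \<open>Q' * f\<close> and its derivative are integrable.\<close>

lemma Q'_by_parts:
  fixes f g :: "real \<Rightarrow> real"
  assumes prim: "\<And>a b. a \<le> b \<Longrightarrow> primitive_on a b f g"
    and m [measurable]: "f \<in> borel_measurable borel" "g \<in> borel_measurable borel"
    and f2: "integrable lborel (\<lambda>x. (f x)\<^sup>2)" and g2: "integrable lborel (\<lambda>x. (g x)\<^sup>2)"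
  shows "(LINT x|lborel. - T x * Q x * g x) = - (LINT x|lborel. (Q x - Q x ^ 5) * f x)"
proof -
  have D: "((\<lambda>x. - T x * Q x) has_real_derivative Q x - Q x ^ 5) (at x)" for x
    unfolding Q_pow5 by (auto intro!: derivative_eq_intros T_deriv Q_deriv simp: algebra_simps power2_eq_square)
  have pQ: "primitive_on a b (\<lambda>x. - T x * Q x) (\<lambda>x. Q x - Q x ^ 5)" if "a \<le> b" for a b
    using that by (intro primitive_on_real_FTC D continuous_intros Q_continuous)
  have i1: "integrable lborel (\<lambda>x. (Q x - Q x ^ 5) * f x)"
    by (intro integrable_product_L2 f2 Q''_square_integrable) auto
  have i2: "integrable lborel (\<lambda>x. - T x * Q x * g x)"
    by (intro integrable_product_L2 g2 Q'_square_integrable) auto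
  have "(LINT x|lborel. (Q x - Q x ^ 5) * f x + - T x * Q x * g x) = 0"
  proof (rule primitive_integral_zero)
    show "integrable lborel (\<lambda>x. - T x * Q x * f x)"
      by (intro integrable_product_L2 f2 Q'_square_integrable) auto
    show "integrable lborel (\<lambda>x. (Q x - Q x ^ 5) * f x + - T x * Q x * g x)"
      by (rule Bochner_Integration.integrable_add[OF i1 i2])
    show "primitive_on a b (\<lambda>x. - T x * Q x * f x) (\<lambda>x. (Q x - Q x ^ 5) * f x + - T x * Q x * g x)"
      if "a \<le> b" for a b
      by (rule primitive_on_mult[OF pQ[OF that] prim[OF that]])
  qed
  then show ?thesis
    unfolding Bochner_Integration.integral_add[OF i1 i2] by linarith
qed

lemma integrable_Q_pow_mult:
  assumes "integrable lborel \<rho>"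
  shows "integrable lborel (\<lambda>x. Q x ^ n * \<rho> x)"
proof (rule integrable_bounded_mult[OF _ assms])
  show "\<bar>Q x ^ n\<bar> \<le> 2 ^ n" for x
    using Q_pos[of x] Q_le[of x] by (simp add: power_abs power_mono)
qed auto

lemma Q_pow6_integrable: "integrable lborel (\<lambda>x. Q x ^ 6)"
  using integrable_Q_pow_mult[OF Q_square_integrable, of 4] by (simp flip: power_add)

text \<open>This says that the soliton has energy zero. Testing the equation with \<open>Q\<close>
  gives one relation, the pointwise first integral of the equation another; together they eliminate
  the mass.\<close>

lemma Q_kinetic: "(LINT x|lborel. (- T x * Q x)\<^sup>2) = (LINT x|lborel. Q x ^ 6) / 3"
proof -
  note i6 = Q_pow6_integrable
  have "(LINT x|lborel. - T x * Q x * (- T x * Q x)) = - (LINT x|lborel. (Q x - Q x ^ 5) * Q x)"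
  proof (rule Q'_by_parts[OF _ _ _ Q_square_integrable Q'_square_integrable])
    show "primitive_on a b Q (\<lambda>x. - T x * Q x)" if "a \<le> b" for a b
      using that by (intro primitive_on_real_FTC Q_deriv continuous_intros T_continuous Q_continuous)
  qed auto
  also have "(LINT x|lborel. (Q x - Q x ^ 5) * Q x) = (LINT x|lborel. (Q x)\<^sup>2 - Q x ^ 6)"
    by (rule Bochner_Integration.integral_cong) (auto simp: eval_nat_numeral algebra_simps)
  also have "\<dots> = (LINT x|lborel. (Q x)\<^sup>2) - (LINT x|lborel. Q x ^ 6)"
    by (rule Bochner_Integration.integral_diff[OF Q_square_integrable i6])
  finally have 1: "(LINT x|lborel. (- T x * Q x)\<^sup>2) = (LINT x|lborel. Q x ^ 6) - (LINT x|lborel. (Q x)\<^sup>2)"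
    by (simp add: power2_eq_square)
  have e: "(- T x * Q x)\<^sup>2 = (Q x)\<^sup>2 - Q x ^ 6 / 3" for x
  proof -
    have "Q x ^ 6 = Q x ^ 4 * (Q x)\<^sup>2" by (simp flip: power_add)
    then show ?thesis unfolding Q_pow4 by (simp add: algebra_simps power_mult_distrib)
  qed
  have "(LINT x|lborel. (- T x * Q x)\<^sup>2) = (LINT x|lborel. (Q x)\<^sup>2) - (LINT x|lborel. Q x ^ 6) / 3"
    unfolding e using Q_square_integrable i6 by simp
  with 1 show ?thesis by simp
qed

subsection \<open>Sobolev bound and energy expansion\<close>

text \<open>The value at \<open>x\<close> is a tail integral of the derivative of the squared
  modulus. A weighted Young inequality with free weight \<open>l\<close> bounds it, and
  \<open>l\<close> is chosen at the end. Treating both components together bounds the modulus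
  directly.\<close>

lemma sobolev_sup_bound:
  fixes f1 g1 f2 g2 :: "real \<Rightarrow> real"
  assumes p1: "\<And>a b. a \<le> b \<Longrightarrow> primitive_on a b f1 g1"
    and p2: "\<And>a b. a \<le> b \<Longrightarrow> primitive_on a b f2 g2"
    and [measurable]: "f1 \<in> borel_measurable borel" "g1 \<in> borel_measurable borel"
      "f2 \<in> borel_measurable borel" "g2 \<in> borel_measurable borel"
    and L2: "integrable lborel (\<lambda>x. (f1 x)\<^sup>2)" "integrable lborel (\<lambda>x. (g1 x)\<^sup>2)"
     "integrable lborel (\<lambda>x. (f2 x)\<^sup>2)" "integrable lborel (\<lambda>x. (g2 x)\<^sup>2)"
  defines "N \<equiv> LINT x|lborel. (f1 x)\<^sup>2 + (f2 x)\<^sup>2"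
    and "D \<equiv> LINT x|lborel. (g1 x)\<^sup>2 + (g2 x)\<^sup>2"
  shows "(f1 x)\<^sup>2 + (f2 x)\<^sup>2 \<le> 2 * sqrt ((D + N) * N)"
proof -
  have bound: "(f1 x)\<^sup>2 + (f2 x)\<^sup>2 \<le> l * N + D / l" if l: "0 < l" for l
  proof -
    let ?F = "\<lambda>x. f1 x * f1 x + f2 x * f2 x"
    let ?G = "\<lambda>x. (g1 x * f1 x + f1 x * g1 x) + (g2 x * f2 x + f2 x * g2 x)"
    let ?R = "\<lambda>x. l * ((f1 x)\<^sup>2 + (f2 x)\<^sup>2) + ((g1 x)\<^sup>2 + (g2 x)\<^sup>2) / l"
    have F: "integrable lborel ?F" using L2 by (simp flip: power2_eq_square)
    have G: "integrable lborel ?G"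
      by (intro Bochner_Integration.integrable_add integrable_product_L2 L2) auto
    have R: "integrable lborel ?R" using L2 by simp
    have yg: "\<bar>2 * (a * b)\<bar> \<le> l * a\<^sup>2 + b\<^sup>2 / l" for a b :: real
    proof -
      have "0 \<le> (l * a + b)\<^sup>2 / l" "0 \<le> (l * a - b)\<^sup>2 / l" using l by auto
      then show ?thesis using l
        by (simp add: power2_sum power2_diff add_divide_distrib diff_divide_distrib power_mult_distrib
            abs_le_iff power2_eq_square algebra_simps)
    qed
    have GR: "\<bar>?G x\<bar> \<le> ?R x" for x
      using yg[of "f1 x" "g1 x"] yg[of "f2 x" "g2 x"]
      by (simp add: algebra_simps add_divide_distrib)
    have "?F x = - (LINT y:{x..}|lborel. ?G y)"
      by (rule primitive_tail_integral[OF F G])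
        (intro primitive_on_add primitive_on_mult p1 p2)
    also have "\<dots> = (LINT y|lborel. - (indicator {x..} y * ?G y))"
      by (simp add: set_lebesgue_integral_def)
    also have "\<dots> \<le> (LINT y|lborel. ?R y)"
    proof (rule integral_mono'[OF R])
      fix y show "- (indicator {x..} y * ?G y) \<le> ?R y" "0 \<le> ?R y"
        using GR[of y] by (auto simp: indicator_def)
    qed
    also have "\<dots> = l * N + D / l"
      unfolding N_def D_def using L2 by simp
    finally show ?thesis by (simp add: power2_eq_square)
  qed
  have N: "0 \<le> N" and D: "0 \<le> D" unfolding N_def D_def by auto
  show ?thesis
  proof (cases "N = 0")
    \<comment> \<open>Here no weight balances the two terms, so \<open>l\<close> is sent to infinity
      instead.\<close>
    case True
    have "(f1 x)\<^sup>2 + (f2 x)\<^sup>2 \<le> 0"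
    proof (rule field_le_epsilon)
      fix e :: real assume e: "0 < e"
      have "(f1 x)\<^sup>2 + (f2 x)\<^sup>2 \<le> D / ((D + 1) / e)"
        using bound[of "(D + 1) / e"] D e True by simp
      also have "\<dots> \<le> e" using D e by (simp add: field_simps)
      finally show "(f1 x)\<^sup>2 + (f2 x)\<^sup>2 \<le> 0 + e" by simp
    qed
    with True show ?thesis by simp
  next
    case False
    \<comment> \<open>With \<open>l = s / N\<close> the first term is \<open>s\<close> and the
      second, \<open>D * N / s\<close>, is at most \<open>s\<close>. Using \<open>D + N\<close> in
      place of \<open>D\<close> keeps \<open>s\<close> positive even if \<open>D\<close> is
      0.\<close>
    define s where "s = sqrt ((D + N) * N)"
    have "0 < N" "0 < (D + N) * N" using False N D by auto
    then have s: "0 < s" "s\<^sup>2 = (D + N) * N" unfolding s_def by auto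
    have "D / (s / N) \<le> s"
      using s \<open>0 < N\<close> by (simp add: field_simps power2_eq_square)
    then show ?thesis using bound[of "s / N"] s \<open>0 < N\<close> by (simp add: s_def)
  qed
qed

text \<open>
  The odd powers of \<open>\<surd>\<rho>\<close> are absorbed into even ones; the weight \<open>d\<close> makes the cubic term small
  against \<open>\<rho>\<close>.
\<close>
lemma sextic_expansion_bound:
  fixes q x y d :: real
  assumes q: "0 \<le> q" "q \<le> 2" and d: "0 < d"
  defines "\<rho> \<equiv> x\<^sup>2 + y\<^sup>2"
  shows "((q + x)\<^sup>2 + y\<^sup>2) ^ 3 \<le> q ^ 6 + 6 * (q ^ 5 * x) + 15 * (q ^ 4 * \<rho>)
           + (80 * d * \<rho> + (80 / d + 66) * \<rho>\<^sup>2 + 7 * \<rho> ^ 3)"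
proof -
  define r where "r = sqrt \<rho>"
  have r: "0 \<le> r" "\<rho> = r\<^sup>2" unfolding r_def \<rho>_def by auto
  have x: "\<bar>x\<bar> \<le> r" unfolding r_def \<rho>_def by (rule real_le_rsqrt) simp
  have x2: "x\<^sup>2 \<le> r\<^sup>2" unfolding r(2)[symmetric] \<rho>_def by simp
  \<comment> \<open>The increment of the squared modulus over \<open>q\<^sup>2\<close>. Its linear
    contribution stays exact; only higher orders are estimated through
    \<open>\<bar>x\<bar> \<le> r\<close>, and the odd cube is monotone whatever the sign of
    \<open>s\<close>.\<close>
  define s where "s = 2 * q * x + r\<^sup>2"
  have "q * x \<le> q * r" using x q by (intro mult_left_mono) auto
  then have "s ^ 3 \<le> (2 * q * r + r\<^sup>2) ^ 3"
    unfolding s_def by (intro power_mono_odd) auto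
  moreover have "3 * q\<^sup>2 * s\<^sup>2 \<le> 12 * q ^ 4 * r\<^sup>2 + 12 * q ^ 3 * r ^ 3 + 3 * q\<^sup>2 * r ^ 4"
  proof -
    have "12 * q ^ 4 * x\<^sup>2 \<le> 12 * q ^ 4 * r\<^sup>2"
      using x2 q by (intro mult_left_mono) auto
    moreover have "12 * q ^ 3 * r\<^sup>2 * x \<le> 12 * q ^ 3 * r\<^sup>2 * r"
      using x q r by (intro mult_left_mono) auto
    moreover have "3 * q\<^sup>2 * s\<^sup>2 = 12 * q ^ 4 * x\<^sup>2 + 12 * q ^ 3 * r\<^sup>2 * x + 3 * q\<^sup>2 * r ^ 4"
      unfolding s_def by algebra
    ultimately show ?thesis by (simp add: eval_nat_numeral algebra_simps)
  qed
  moreover have "((q + x)\<^sup>2 + y\<^sup>2) = q\<^sup>2 + s"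
    unfolding s_def r(2)[symmetric] \<rho>_def by (simp add: power2_sum)
  moreover have "(q\<^sup>2 + s) ^ 3 = q ^ 6 + 3 * q ^ 4 * s + 3 * q\<^sup>2 * s\<^sup>2 + s ^ 3"
    by algebra
  moreover have "3 * q ^ 4 * s = 6 * (q ^ 5 * x) + 3 * (q ^ 4 * r\<^sup>2)"
    unfolding s_def by algebra
  moreover have "(2 * q * r + r\<^sup>2) ^ 3 = 8 * q ^ 3 * r ^ 3 + 12 * q\<^sup>2 * r ^ 4 + 6 * q * r ^ 5 + r ^ 6"
    by algebra
  ultimately have "((q + x)\<^sup>2 + y\<^sup>2) ^ 3 \<le> q ^ 6 + 6 * (q ^ 5 * x) + 15 * (q ^ 4 * r\<^sup>2)
     + (20 * q ^ 3 * r ^ 3 + 15 * q\<^sup>2 * r ^ 4 + 6 * q * r ^ 5 + r ^ 6)"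
    by (simp add: algebra_simps)
  also have "20 * q ^ 3 * r ^ 3 + 15 * q\<^sup>2 * r ^ 4 + 6 * q * r ^ 5 + r ^ 6
     \<le> 80 * d * r\<^sup>2 + (80 / d + 66) * r ^ 4 + 7 * r ^ 6"
  proof -
    have "q ^ 3 \<le> 8" "q\<^sup>2 \<le> 4"
      using power_mono[of q 2 3] power_mono[of q 2 2] q by simp_all
    then have "20 * q ^ 3 * r ^ 3 \<le> 160 * r ^ 3" "15 * q\<^sup>2 * r ^ 4 \<le> 60 * r ^ 4" "6 * q * r ^ 5 \<le> 12 * r ^ 5"
      using r q by (auto intro!: mult_right_mono)
    moreover have "160 * r ^ 3 \<le> 80 * d * r\<^sup>2 + 80 / d * r ^ 4"
    proof -
      have "0 \<le> 80 * r\<^sup>2 * ((d - r)\<^sup>2 / d)" using d by (intro mult_nonneg_nonneg divide_nonneg_pos) auto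
      also have "\<dots> = 80 * d * r\<^sup>2 + 80 / d * r ^ 4 - 160 * r ^ 3"
        using d by (simp add: field_simps power2_eq_square eval_nat_numeral)
      finally show ?thesis by simp
    qed
    moreover have "12 * r ^ 5 \<le> 6 * r ^ 4 + 6 * r ^ 6"
    proof -
      have "0 \<le> 6 * r ^ 4 * (1 - r)\<^sup>2" using r by simp
      also have "\<dots> = 6 * r ^ 4 + 6 * r ^ 6 - 12 * r ^ 5" by algebra
      finally show ?thesis by simp
    qed
    ultimately show ?thesis by (simp add: algebra_simps)
  qed
  finally show ?thesis unfolding r(2) by (simp flip: power_mult)
qed

text \<open>The parameter \<open>d\<close> both bounds the perturbation and serves as the weight
  absorbing the cubic term. In the energy \<open>q6\<close> and \<open>P5\<close> cancel, leaving
  half of \<open>D + N - 5 * P4\<close> minus one sixth of the remainder.\<close>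

lemma energy_coercivity:
  fixes f1 g1 f2 g2 :: "real \<Rightarrow> real" and d :: real
  assumes p1: "\<And>a b. a \<le> b \<Longrightarrow> primitive_on a b f1 g1"
    and p2: "\<And>a b. a \<le> b \<Longrightarrow> primitive_on a b f2 g2"
    and m1 [measurable]: "f1 \<in> borel_measurable borel" "g1 \<in> borel_measurable borel"
    and m2 [measurable]: "f2 \<in> borel_measurable borel" "g2 \<in> borel_measurable borel"
    and f1: "integrable lborel (\<lambda>x. (f1 x)\<^sup>2)" and g1: "integrable lborel (\<lambda>x. (g1 x)\<^sup>2)"
    and f2: "integrable lborel (\<lambda>x. (f2 x)\<^sup>2)" and g2: "integrable lborel (\<lambda>x. (g2 x)\<^sup>2)"
    and even: "AE x in lborel. f1 (- x) = f1 x" "AE x in lborel. f2 (- x) = f2 x"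
    and orth: "(LINT x|lborel. Q x ^ 3 * f1 x) = 0" "(LINT x|lborel. Q x ^ 3 * f2 x) = 0"
    and mass: "(LINT x|lborel. (Q x + f1 x)\<^sup>2 + (f2 x)\<^sup>2) = (LINT x|lborel. (Q x)\<^sup>2)"
    and d: "0 < d" "d \<le> 1 / 10000"
  defines "N \<equiv> LINT x|lborel. (f1 x)\<^sup>2 + (f2 x)\<^sup>2"
    and "D \<equiv> LINT x|lborel. (g1 x)\<^sup>2 + (g2 x)\<^sup>2"
  assumes N_le: "N \<le> d\<^sup>2"
  shows "(1 / 100) * (D + N) \<le> (1/2) * (LINT x|lborel. (- T x * Q x + g1 x)\<^sup>2 + (g2 x)\<^sup>2)
     - (1/6) * (LINT x|lborel. ((Q x + f1 x)\<^sup>2 + (f2 x)\<^sup>2) ^ 3)"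
proof -
  define \<rho> where "\<rho> x = (f1 x)\<^sup>2 + (f2 x)\<^sup>2" for x
  have [measurable]: "\<rho> \<in> borel_measurable borel" unfolding \<rho>_def[abs_def] by measurable
  have \<rho>0: "0 \<le> \<rho> x" for x by (simp add: \<rho>_def)
  have \<rho>1: "integrable lborel \<rho>" unfolding \<rho>_def[abs_def] using f1 f2 by simp
  have N: "N = (LINT x|lborel. \<rho> x)" by (simp add: N_def \<rho>_def)
  have D: "D = (LINT x|lborel. (g1 x)\<^sup>2) + (LINT x|lborel. (g2 x)\<^sup>2)"
    unfolding D_def using g1 g2 by simp
  have ND: "0 \<le> N" "0 \<le> D" unfolding N_def D_def by auto
  define M where "M = 2 * sqrt ((D + N) * N)"
  have M: "0 \<le> M" using ND by (simp add: M_def)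
  have \<rho>M: "\<rho> x \<le> M" for x
    unfolding \<rho>_def M_def N_def D_def by (rule sobolev_sup_bound[OF p1 p2 m1 m2 f1 g1 f2 g2])
  have \<rho>2: "integrable lborel (\<lambda>x. (\<rho> x)\<^sup>2)"
    using integrable_bounded_mult[of \<rho> \<rho> M] \<rho>1 \<rho>M \<rho>0 by (simp add: power2_eq_square)
  have \<rho>3: "integrable lborel (\<lambda>x. \<rho> x ^ 3)"
    using integrable_bounded_mult[of \<rho> "\<lambda>x. (\<rho> x)\<^sup>2" M] \<rho>2 \<rho>M \<rho>0
    by (simp add: power2_eq_square power3_eq_cube mult.assoc)
  define R2 R3 where "R2 = (LINT x|lborel. (\<rho> x)\<^sup>2)" and "R3 = (LINT x|lborel. \<rho> x ^ 3)"
  have "R2 \<le> (LINT x|lborel. M * \<rho> x)"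
    unfolding R2_def by (rule integral_mono'[OF integrable_mult_right[OF \<rho>1]])
      (auto simp: power2_eq_square intro!: mult_right_mono mult_nonneg_nonneg \<rho>M \<rho>0 M)
  then have R2_M: "R2 \<le> M * N" using N by simp
  have "R3 \<le> (LINT x|lborel. M\<^sup>2 * \<rho> x)"
    unfolding R3_def
  proof (rule integral_mono'[OF integrable_mult_right[OF \<rho>1]])
    fix x
    have "(\<rho> x)\<^sup>2 \<le> M\<^sup>2" using \<rho>M \<rho>0 by (rule power_mono)
    then show "\<rho> x ^ 3 \<le> M\<^sup>2 * \<rho> x"
      using \<rho>0[of x] by (simp add: power2_eq_square power3_eq_cube mult_right_mono)
  qed (use \<rho>0 in auto)
  then have R3_M: "R3 \<le> M\<^sup>2 * N" using N by simp
  have M2: "M\<^sup>2 = 4 * ((D + N) * N)" unfolding M_def using ND by (simp add: power_mult_distrib)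
  have "M \<le> 2 * (D + N)"
  proof (rule power2_le_imp_le)
    show "M\<^sup>2 \<le> (2 * (D + N))\<^sup>2"
      unfolding M2 using mult_left_mono[of N "D + N" "D + N"] ND
      by (simp add: power2_eq_square algebra_simps)
  qed (use ND in auto)
  then have "M * N \<le> 2 * (D + N) * d\<^sup>2"
    using ND N_le by (intro mult_mono) auto
  with R2_M have R2: "R2 \<le> 2 * (D + N) * d\<^sup>2" by linarith
  have "M\<^sup>2 * N \<le> 4 * ((D + N) * d\<^sup>2) * d\<^sup>2"
    unfolding M2 using ND N_le by (intro mult_mono) auto
  with R3_M have R3: "R3 \<le> 4 * ((D + N) * d\<^sup>2) * d\<^sup>2" by linarith
  define H where "H = D + N"
  have H: "0 \<le> H" "N \<le> H" using ND by (auto simp: H_def)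
  \<comment> \<open>The pieces cost 80, 160, 132 and 28 times \<open>d * H\<close>. The factor
    \<open>80 / d\<close> is harmless because the bound on \<open>R2\<close> carries
    \<open>d\<^sup>2\<close>.\<close>
  have rest: "80 * d * N + (80 / d + 66) * R2 + 7 * R3 \<le> 400 * d * H"
  proof -
    have d2: "d\<^sup>2 \<le> d" using d by (simp add: power2_eq_square mult_left_le_one_le)
    have "80 * d * N \<le> 80 * d * H" using H d by (intro mult_left_mono) auto
    moreover have "80 / d * R2 \<le> 80 / d * (2 * H * d\<^sup>2)"
      using R2 d unfolding H_def by (intro mult_left_mono) auto
    then have "80 / d * R2 \<le> 160 * d * H" using d by (simp add: power2_eq_square mult.commute)
    moreover have "66 * R2 \<le> 132 * (H * d\<^sup>2)" using R2 unfolding H_def by (simp add: algebra_simps)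
    then have "66 * R2 \<le> 132 * (d * H)"
      using mult_left_mono[OF d2 H(1)] by (simp add: mult.commute)
    moreover have "7 * R3 \<le> 28 * (d * H)"
    proof -
      have "H * d\<^sup>2 * d\<^sup>2 \<le> H * d * 1"
        using d d2 H by (intro mult_mono) auto
      then show ?thesis using R3 unfolding H_def by (simp add: algebra_simps)
    qed
    moreover have "0 \<le> d * H" using d H by simp
    ultimately show ?thesis by (simp add: algebra_simps)
  qed
  define P4 P5 q6 where "P4 = (LINT x|lborel. Q x ^ 4 * \<rho> x)"
    and "P5 = (LINT x|lborel. Q x ^ 5 * f1 x)" and "q6 = (LINT x|lborel. Q x ^ 6)"
  have P4_D: "5 * P4 \<le> D"
  proof -
    have i: "integrable lborel (\<lambda>x. Q x ^ 4 * (f1 x)\<^sup>2)" "integrable lborel (\<lambda>x. Q x ^ 4 * (f2 x)\<^sup>2)"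
      using f1 f2 by (auto intro: integrable_Q_pow_mult)
    have "5 * P4 = (LINT x|lborel. 5 * (Q x ^ 4 * (f1 x)\<^sup>2)) + (LINT x|lborel. 5 * (Q x ^ 4 * (f2 x)\<^sup>2))"
      unfolding P4_def \<rho>_def using i by (simp add: distrib_left)
    also have "\<dots> \<le> D"
      unfolding D
      by (intro add_mono even_coercivity[OF p1 m1 f1 g1 even(1) orth(1)]
          even_coercivity[OF p2 m2 f2 g2 even(2) orth(2)])
    finally show ?thesis .
  qed
  \<comment> \<open>Coercivity alone leaves only \<open>N\<close>. This crude bound lets part of
    that gain be traded for control of \<open>D\<close>.\<close>
  have P4_N: "P4 \<le> 3 * N"
  proof -
    have "P4 \<le> (LINT x|lborel. 3 * \<rho> x)"
      unfolding P4_def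
    proof (rule integral_mono')
      fix x show "Q x ^ 4 * \<rho> x \<le> 3 * \<rho> x"
        unfolding Q_pow4 using \<rho>0 by (intro mult_right_mono) auto
    qed (use \<rho>0 \<rho>1 in auto)
    then show ?thesis using N by simp
  qed
  have iQf: "integrable lborel (\<lambda>x. Q x * f1 x)"
    by (intro integrable_product_L2 Q_square_integrable f1) auto
  have iQ5f: "integrable lborel (\<lambda>x. Q x ^ 5 * f1 x)"
    using integrable_Q_pow_mult[OF iQf, of 4] by (simp add: eval_nat_numeral mult.assoc)
  \<comment> \<open>Equal masses turn the linear term in \<open>Q\<close> into a quadratic one; this
    produces the mass term of the quadratic form.\<close>
  have Qf: "(LINT x|lborel. Q x * f1 x) = - N / 2"
  proof -
    have "(LINT x|lborel. (Q x + f1 x)\<^sup>2 + (f2 x)\<^sup>2) = (LINT x|lborel. (Q x)\<^sup>2 + (2 * (Q x * f1 x) + \<rho> x))"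
      by (rule Bochner_Integration.integral_cong) (auto simp: \<rho>_def power2_sum)
    also have "\<dots> = (LINT x|lborel. (Q x)\<^sup>2) + (2 * (LINT x|lborel. Q x * f1 x) + N)"
      using Q_square_integrable iQf \<rho>1 by (simp add: N)
    finally show ?thesis using mass by simp
  qed
  have kinetic: "(LINT x|lborel. (- T x * Q x + g1 x)\<^sup>2 + (g2 x)\<^sup>2) = q6 / 3 + 2 * (N / 2 + P5) + D"
  proof -
    have i: "integrable lborel (\<lambda>x. - T x * Q x * g1 x)"
      by (intro integrable_product_L2 Q'_square_integrable g1) auto
    have "(LINT x|lborel. - T x * Q x * g1 x) = - (LINT x|lborel. Q x * f1 x - Q x ^ 5 * f1 x)"
      using Q'_by_parts[OF p1 m1 f1 g1] by (simp add: left_diff_distrib)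
    also have "\<dots> = N / 2 + P5"
      using iQf iQ5f Qf by (simp add: P5_def)
    finally have c: "(LINT x|lborel. - T x * Q x * g1 x) = N / 2 + P5" .
    have "(LINT x|lborel. (- T x * Q x + g1 x)\<^sup>2 + (g2 x)\<^sup>2)
       = (LINT x|lborel. (- T x * Q x)\<^sup>2 + (2 * (- T x * Q x * g1 x) + ((g1 x)\<^sup>2 + (g2 x)\<^sup>2)))"
      by (rule Bochner_Integration.integral_cong) (auto simp: power2_eq_square algebra_simps)
    also have "\<dots> = (LINT x|lborel. (- T x * Q x)\<^sup>2) + ((LINT x|lborel. 2 * (- T x * Q x * g1 x)) + D)"
      unfolding D_def
      by (subst Bochner_Integration.integral_add, rule Q'_square_integrable,
          use i g1 g2 in \<open>(intro Bochner_Integration.integrable_add integrable_mult_right)\<close>)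
        (use i g1 g2 in simp_all)
    also have "(LINT x|lborel. 2 * (- T x * Q x * g1 x)) = 2 * (N / 2 + P5)"
      unfolding c[symmetric] by (rule integral_mult_right_zero)
    finally show ?thesis unfolding Q_kinetic q6_def by simp
  qed
  have potential: "(LINT x|lborel. ((Q x + f1 x)\<^sup>2 + (f2 x)\<^sup>2) ^ 3)
     \<le> q6 + 6 * P5 + 15 * P4 + (80 * d * N + (80 / d + 66) * R2 + 7 * R3)"
  proof -
    let ?U = "\<lambda>x. Q x ^ 6 + 6 * (Q x ^ 5 * f1 x) + 15 * (Q x ^ 4 * \<rho> x)
       + (80 * d * \<rho> x + (80 / d + 66) * (\<rho> x)\<^sup>2 + 7 * \<rho> x ^ 3)"
    have U: "((Q x + f1 x)\<^sup>2 + (f2 x)\<^sup>2) ^ 3 \<le> ?U x" for x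
      unfolding \<rho>_def by (rule sextic_expansion_bound) (use Q_pos[of x] Q_le[of x] d in auto)
    note i = Q_pow6_integrable iQ5f integrable_Q_pow_mult[OF \<rho>1, of 4] \<rho>1 \<rho>2 \<rho>3
    have "(LINT x|lborel. ((Q x + f1 x)\<^sup>2 + (f2 x)\<^sup>2) ^ 3) \<le> (LINT x|lborel. ?U x)"
    proof (rule integral_mono')
      show "integrable lborel ?U" using i by simp
      \<comment> \<open>A nonnegative integrable majorant suffices: a nonintegrable left side would
        have the default integral 0.\<close>
      show "0 \<le> ?U x" for x
        by (rule order_trans[OF _ U]) simp
    qed (rule U)
    also have "\<dots> = q6 + 6 * P5 + 15 * P4 + (80 * d * N + (80 / d + 66) * R2 + 7 * R3)"
      using i by (simp add: q6_def P5_def P4_def N R2_def R3_def)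
    finally show ?thesis .
  qed
  \<comment> \<open>The remainder thus costs at most \<open>H / 150\<close>. Weighting
    \<open>P4_D\<close> by 15/16 and \<open>P4_N\<close> by 1/16 gives
    \<open>D + N - 5 * P4 \<ge> (D + N) / 16\<close>, and 1/32 - 1/150 exceeds 1/100.\<close>
  have "400 * d * H \<le> 400 * (1 / 10000) * H"
    using d H by (intro mult_right_mono) auto
  with kinetic potential rest P4_D P4_N ND show ?thesis
    unfolding H_def by argo
qed

section \<open>Reduction of the complex statement to real and imaginary parts\<close>

theorem theorem3p3:
  shows "\<exists>\<delta>>0. \<exists>c>0. \<forall>(\<epsilon>::real \<Rightarrow> complex) (g::real \<Rightarrow> complex).
     H1_with_deriv \<epsilon> g \<and>
     (AE x in lborel. \<epsilon> (-x) = \<epsilon> x) \<and>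
     L2ip \<epsilon> (\<lambda>x. (Qc x)^3) = 0 \<and>
     L2ip \<epsilon> (\<lambda>x. \<i> * (Qc x)^3) = 0 \<and>
     L2norm \<epsilon> \<le> \<delta> \<and>
     L2norm (\<lambda>x. Qc x + \<epsilon> x) = L2norm Qc
     \<longrightarrow> energy (\<lambda>x. Qc x + \<epsilon> x) (\<lambda>x. Qc' x + g x)
           \<ge> c * ((LINT x|lborel. (cmod (g x))^2) + (LINT x|lborel. (cmod (\<epsilon> x))^2))"
proof (intro exI conjI allI impI)
  show "(0::real) < 1 / 10000" "(0::real) < 1 / 100" by simp_all
  fix \<epsilon> g :: "real \<Rightarrow> complex"
  assume *: "H1_with_deriv \<epsilon> g \<and>
     (AE x in lborel. \<epsilon> (-x) = \<epsilon> x) \<and>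
     L2ip \<epsilon> (\<lambda>x. (Qc x)^3) = 0 \<and>
     L2ip \<epsilon> (\<lambda>x. \<i> * (Qc x)^3) = 0 \<and>
     L2norm \<epsilon> \<le> 1 / 10000 \<and>
     L2norm (\<lambda>x. Qc x + \<epsilon> x) = L2norm Qc"
  then obtain v where m\<epsilon>[measurable]: "\<epsilon> \<in> borel_measurable borel" and mg[measurable]: "g \<in> borel_measurable borel"
    and i\<epsilon>: "integrable lborel (\<lambda>x. (cmod (\<epsilon> x))\<^sup>2)" and ig: "integrable lborel (\<lambda>x. (cmod (g x))\<^sup>2)"
    and v: "AE x in lborel. \<epsilon> x = v x" "\<And>a b. a \<le> b \<Longrightarrow> v b - v a = (LBINT t=a..b. g t)"
    unfolding H1_with_deriv_def by auto
  \<comment> \<open>The components come from the absolutely continuous representative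
    \<open>v\<close>, not from \<open>\<epsilon>\<close>; the hypotheses are transferred to it
    almost everywhere.\<close>
  define f1 f2 where "f1 x = Re (v x)" and "f2 x = Im (v x)" for x
  define g1 g2 where "g1 x = Re (g x)" and "g2 x = Im (g x)" for x
  note gI = set_integrable_Icc_if_L2[OF mg ig]
  have vg: "(LINT t:{a..b}|lborel. g t) = v b - v a" if "a \<le> b" for a b
    using v(2)[OF that] unfolding interval_integral_Icc[OF that] by simp
  have p1: "primitive_on a b f1 g1" for a b
    unfolding primitive_on_def
  proof safe
    have Re: "set_integrable lborel {a..x} g1 \<and> (LINT t:{a..x}|lborel. g1 t) = Re (LINT t:{a..x}|lborel. g t)" for x
      using gI[of a x] integrable_Re[OF gI[of a x, unfolded set_integrable_def]] integral_Re[OF gI[of a x, unfolded set_integrable_def]]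
      by (simp add: set_integrable_def set_lebesgue_integral_def g1_def[abs_def])
    then show "set_integrable lborel {a..b} g1" by blast
    fix x assume "x \<in> {a..b}"
    then show "(LINT t:{a..x}|lborel. g1 t) = f1 x - f1 a"
      using Re[of x] vg[of a x] by (simp add: f1_def)
  qed
  have p2: "primitive_on a b f2 g2" for a b
    unfolding primitive_on_def
  proof safe
    have Im: "set_integrable lborel {a..x} g2 \<and> (LINT t:{a..x}|lborel. g2 t) = Im (LINT t:{a..x}|lborel. g t)" for x
      using gI[of a x] integrable_Im[OF gI[of a x, unfolded set_integrable_def]] integral_Im[OF gI[of a x, unfolded set_integrable_def]]
      by (simp add: set_integrable_def set_lebesgue_integral_def g2_def[abs_def])
    then show "set_integrable lborel {a..b} g2" by blast
    fix x assume "x \<in> {a..b}"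
    then show "(LINT t:{a..x}|lborel. g2 t) = f2 x - f2 a"
      using Im[of x] vg[of a x] by (simp add: f2_def)
  qed
  have m1[measurable]: "f1 \<in> borel_measurable borel" "g1 \<in> borel_measurable borel"
    and m2[measurable]: "f2 \<in> borel_measurable borel" "g2 \<in> borel_measurable borel"
    using borel_measurable_continuous_onI[OF continuous_on_primitive[OF p1]]
      borel_measurable_continuous_onI[OF continuous_on_primitive[OF p2]]
    unfolding g1_def[abs_def] g2_def[abs_def] by auto
  \<comment> \<open>Measurability of \<open>v\<close> is not part of the definition of the Sobolev
    space; it follows from the continuity of its components.\<close>
  have mv[measurable]: "v \<in> borel_measurable borel"
    using m1(1) m2(1) unfolding f1_def[abs_def] f2_def[abs_def] by (simp add: borel_measurable_complex_iff)
  have v_eq: "v x = complex_of_real (f1 x) + \<i> * complex_of_real (f2 x)" for x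
    by (simp add: f1_def f2_def complex_eq_iff)
  have iv: "integrable lborel (\<lambda>x. (cmod (v x))\<^sup>2)"
    using i\<epsilon> by (rule integrable_cong_AE_imp) (use v(1) in auto)
  have sq: "integrable lborel (\<lambda>x. (Re (u x))\<^sup>2)" "integrable lborel (\<lambda>x. (Im (u x))\<^sup>2)"
    if "integrable lborel (\<lambda>x. (cmod (u x))\<^sup>2)" "u \<in> borel_measurable borel" for u :: "real \<Rightarrow> complex"
    by (rule Bochner_Integration.integrable_bound[OF that(1)]; use that(2) in \<open>simp add: cmod_power2\<close>)+
  have f12: "integrable lborel (\<lambda>x. (f1 x)\<^sup>2)" "integrable lborel (\<lambda>x. (f2 x)\<^sup>2)"
    unfolding f1_def f2_def by (rule sq[OF iv mv])+
  have g12: "integrable lborel (\<lambda>x. (g1 x)\<^sup>2)" "integrable lborel (\<lambda>x. (g2 x)\<^sup>2)"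
    unfolding g1_def g2_def by (rule sq[OF ig mg])+
  \<comment> \<open>Reflection preserves null sets, so the exceptional set may be reflected
    too.\<close>
  have "AE x in lborel. \<epsilon> (- x) = v (- x)"
    by (rule AE_lborel_uminus[OF _ v(1)]) measurable
  moreover have "AE x in lborel. \<epsilon> (- x) = \<epsilon> x" using * by blast
  ultimately have "AE x in lborel. v (- x) = v x"
    using v(1) by eventually_elim simp
  then have even: "AE x in lborel. f1 (- x) = f1 x" "AE x in lborel. f2 (- x) = f2 x"
    unfolding f1_def f2_def by (auto elim!: eventually_mono)
  have "(LINT x|lborel. \<epsilon> x * cnj (Qc x ^ 3)) =
     (LINT x|lborel. complex_of_real (Q x ^ 3 * f1 x) + \<i> * complex_of_real (Q x ^ 3 * f2 x))"
  proof (rule integral_cong_AE)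
    show "(\<lambda>x. \<epsilon> x * cnj (Qc x ^ 3)) \<in> borel_measurable lborel"
      unfolding Qc_def[abs_def] complex_cnj_power complex_cnj_complex_of_real by measurable
    show "AE x in lborel. \<epsilon> x * cnj (Qc x ^ 3) = complex_of_real (Q x ^ 3 * f1 x) + \<i> * complex_of_real (Q x ^ 3 * f2 x)"
      using v(1) by eventually_elim (simp add: v_eq Qc_def algebra_simps)
  qed measurable
  also have "\<dots> = complex_of_real (LINT x|lborel. Q x ^ 3 * f1 x) + \<i> * complex_of_real (LINT x|lborel. Q x ^ 3 * f2 x)"
    using integrable_product_L2[OF _ m1(1) Q_cube_square_integrable f12(1)]
      integrable_product_L2[OF _ m2(1) Q_cube_square_integrable f12(2)]
    by (subst Bochner_Integration.integral_add)
      (auto simp del: of_real_mult of_real_power simp: integral_complex_of_real)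
  finally have ip: "(LINT x|lborel. \<epsilon> x * cnj (Qc x ^ 3)) =
     complex_of_real (LINT x|lborel. Q x ^ 3 * f1 x) + \<i> * complex_of_real (LINT x|lborel. Q x ^ 3 * f2 x)" .
  have orth1: "(LINT x|lborel. Q x ^ 3 * f1 x) = 0"
    using * ip unfolding L2ip_def by simp
  \<comment> \<open>The factor \<open>- \<i>\<close> rotates the integral, so the real part in
    \<open>L2ip\<close> now reads off the component \<open>f2\<close>.\<close>
  have "(LINT x|lborel. \<epsilon> x * cnj (\<i> * Qc x ^ 3)) = - \<i> * (LINT x|lborel. \<epsilon> x * cnj (Qc x ^ 3))"
    by (subst integral_mult_right_zero[symmetric], rule Bochner_Integration.integral_cong) auto
  then have orth2: "(LINT x|lborel. Q x ^ 3 * f2 x) = 0"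
    using * ip unfolding L2ip_def by simp
  have N: "(LINT x|lborel. (cmod (\<epsilon> x))\<^sup>2) = (LINT x|lborel. (f1 x)\<^sup>2 + (f2 x)\<^sup>2)"
    by (rule integral_cong_AE) (use v(1) in \<open>auto elim!: eventually_mono simp: cmod_power2 f1_def f2_def\<close>)
  have D: "(LINT x|lborel. (cmod (g x))\<^sup>2) = (LINT x|lborel. (g1 x)\<^sup>2 + (g2 x)\<^sup>2)"
    by (simp add: cmod_power2 g1_def g2_def)
  \<comment> \<open>The case \<open>n = 1\<close> serves the mass constraint, the case
    \<open>n = 3\<close> the sextic term of the energy.\<close>
  have QN: "(LINT x|lborel. (cmod (Qc x + \<epsilon> x)) ^ (2 * n)) = (LINT x|lborel. ((Q x + f1 x)\<^sup>2 + (f2 x)\<^sup>2) ^ n)" for n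
  proof (rule integral_cong_AE)
    show "(\<lambda>x. (cmod (Qc x + \<epsilon> x)) ^ (2 * n)) \<in> borel_measurable lborel"
      unfolding Qc_def[abs_def] by measurable
    show "AE x in lborel. (cmod (Qc x + \<epsilon> x)) ^ (2 * n) = ((Q x + f1 x)\<^sup>2 + (f2 x)\<^sup>2) ^ n"
      using v(1) by eventually_elim (simp add: power_mult cmod_power2 f1_def f2_def Qc_def)
  qed measurable
  have mass: "(LINT x|lborel. (Q x + f1 x)\<^sup>2 + (f2 x)\<^sup>2) = (LINT x|lborel. (Q x)\<^sup>2)"
    using * QN[of 1] by (simp add: L2norm_def Qc_def Q_pos less_imp_le)
  have "(LINT x|lborel. (cmod (\<epsilon> x))\<^sup>2) \<le> (1 / 10000)\<^sup>2"
    using * by (intro sqrt_le_D) (simp add: L2norm_def)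
  then have small: "(LINT x|lborel. (f1 x)\<^sup>2 + (f2 x)\<^sup>2) \<le> (1 / 10000)\<^sup>2" unfolding N .
  have "(1 / 100) * ((LINT x|lborel. (g1 x)\<^sup>2 + (g2 x)\<^sup>2) + (LINT x|lborel. (f1 x)\<^sup>2 + (f2 x)\<^sup>2))
    \<le> (1/2) * (LINT x|lborel. (- T x * Q x + g1 x)\<^sup>2 + (g2 x)\<^sup>2)
     - (1/6) * (LINT x|lborel. ((Q x + f1 x)\<^sup>2 + (f2 x)\<^sup>2) ^ 3)"
    by (rule energy_coercivity[OF p1 p2 m1 m2 f12(1) g12(1) f12(2) g12(2) even orth1 orth2 mass _ _ small]) simp_all
  also have "\<dots> = energy (\<lambda>x. Qc x + \<epsilon> x) (\<lambda>x. Qc' x + g x)"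
  proof -
    have "deriv Q x = - T x * Q x" for x by (rule DERIV_imp_deriv[OF Q_deriv])
    then show ?thesis
      using QN[of 3] by (simp add: energy_def Qc'_def cmod_power2 g1_def g2_def)
  qed
  finally show "1 / 100 * ((LINT x|lborel. (cmod (g x))\<^sup>2) + (LINT x|lborel. (cmod (\<epsilon> x))\<^sup>2))
      \<le> energy (\<lambda>x. Qc x + \<epsilon> x) (\<lambda>x. Qc' x + g x)"
    unfolding N D .
qed

end
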